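(* Let $p$ be a prime, $K$ an F-finite field of characteristic $p$, $S=K[x_1,\dots,x_m]$, let $I=(\mathbf{x}^{\mathbf{a}_1},\dots,\mathbf{x}^{\mathbf{a}_n})\subsetneq S$ be a monomial ideal ($n\ge 1$), and let $A=(\mathbf{a}_1|\cdots|\mathbf{a}_n)$. Let $\mathbf{x}^{\mathbf{b}}\notin I$ be a monomial. Then the procedure described in the context, applied to $(p,A,\mathbf{b})$, terminates (that is, $\mathcal{L}_e=\varnothing$ for all sufficiently large $e$), the resulting set $\Lambda$ is finite, and for any $\mathbf{u}_*\in\Lambda$ maximizing $\|\mathbf{u}_*\|$ one has $$\lambda_{\mathbf{b}}(I)=\|\mathbf{u}_*\|,$$ and the vectors $\tau_e(\mathbf{u}_* )$, $e\ge 0$, obtained by truncating each entry of $\mathbf{u}_*$ (written as in the procedure) after $e$ base $p$ places, form a convergent family of witnesses for $\lambda_{\mathbf{b}}(I)$.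
   Context: Frobenius powers. $K$ is F-finite if it is finitely generated over $K^p$. $q$ always denotes a power $p^e$, $e\ge 0$; $\mathbb{N}$ includes $0$. For an ideal $J\subseteq S$, $J^{[q]}=(f^q\mid f\in J)$ and $J^{[1/q]}$ is the smallest ideal $L$ with $L^{[q]}\supseteq J$. For an integer $k\ge 0$ with base $p$ expansion $k=k_0+k_1p+\cdots+k_rp^r$, $I^{[k]}=I^{k_0}(I^{k_1})^{[p]}\cdots(I^{k_r})^{[p^r]}$. Put $I^{[k/q]}=(I^{[k]})^{[1/q]}$. For real $\lambda\ge 0$, $I^{[\lambda]}$ is the stable value of the ascending chain $I^{[\lambda_1]}\subseteq I^{[\lambda_2]}\subseteq\cdots$ for any monotone decreasing sequence $(\lambda_j)$ of rationals of the form $k/q$ converging to $\lambda$ from above. For $\mathbf{b}\in\mathbb{N}^m$, $\lambda_{\mathbf{b}}(I)=\sup\{\lambda\in\mathbb{R}_{\ge 0}\mid \mathbf{x}^{\mathbf{b}}\in I^{[\lambda]}\}$. Vectors. $\|\mathbf{u}\|=\sum_i u_i$; $\mathbf{1}=(1,\dots,1)$; $\mathbf{u}\prec\mathbf{v}$ means $u_i<v_i$ for all $i$. $\mathcal{S}_{p,n}$ is the set of $(u_1,\dots,u_n)$ with $0\le u_i\le 1$, each $u_i$ a terminating base $p$ decimal, such that $\sum u_i$ adds without carries (in each place the digits sum to less than $p$). An $e$-witness for $\lambda=\lambda_{\mathbf{b}}(I)$ is $\mathbf{v}\in\mathcal{S}_{p,n}\cap\frac1{p^e}\mathbb{N}^n$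 with $A\mathbf{v}\prec\mathbf{b}+\mathbf{1}$ and $\lambda-\frac1{p^e}\le\|\mathbf{v}\|<\lambda$. A convergent family of witnesses is a sequence $\{\mathbf{v}_e\}$ such that each $\mathbf{v}_e$ is an $e$-witness and each component of $\mathbf{v}_{e+1}$ agrees with that of $\mathbf{v}_e$ to $e$ base $p$ places. Procedure. Let $\Omega$ be an integer such that every entry of $A\mathbf{v}$ is at most $\Omega$ for all $\mathbf{v}\in\mathbb{N}^n$ with $\|\mathbf{v}\|<p$. Start with $\Lambda=\varnothing$ and $\mathcal{L}_0=\{(\mathbf{0},())\}$. For $e=1,2,\dots$, construct $\mathcal{L}_e$ from $\mathcal{L}_{e-1}$, whose elements are pairs $(\mathbf{u},(\mathbf{r}_0,\dots,\mathbf{r}_{e-2}))$ with $\mathbf{u}\in\frac{1}{p^{e-1}}\mathbb{N}^n$, $u_i=0.u_{i,1}u_{i,2}\dots u_{i,e-1}$ in base $p$, as follows. For each such pair: (1) Compute $\mathbf{r}_{e-1}=p^{e-1}(\mathbf{b}+\mathbf{1}-A\mathbf{u})$ and replace every entry greater than $\Omega$ by $\Omega$. (2) If $\mathbf{r}_{e-1}=\mathbf{r}_c$ for some $c<e-1$, add to $\Lambda$ the vector $\widetilde{\mathbf{u}}$ whose $i$-th entry is the base $p$ repeating decimal $0.u_{i,1}\dots u_{i,c}\,\overline{u_{i,c+1}\dots u_{i,e-1}}$. (3) If not, find all $\mathbf{v}\in\mathbb{N}^n$ maximizing $\|\mathbf{v}\|$ subject to $A\mathbf{v}\prec p\,\mathbf{r}_{e-1}$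 and $\|\mathbf{v}\|<p$, and put each pair $(\mathbf{u}+\frac1{p^e}\mathbf{v},(\mathbf{r}_0,\dots,\mathbf{r}_{e-1}))$ into $\mathcal{L}_e$. After treating all pairs in $\mathcal{L}_{e-1}$, let $\lambda_e$ be the maximum of $\|\mathbf{w}\|$ over the pairs $(\mathbf{w},R)\in\mathcal{L}_e$ and delete from $\mathcal{L}_e$ all pairs with $\|\mathbf{w}\|<\lambda_e$. Stop when $\mathcal{L}_e=\varnothing$. *)

theory Defs
  imports
    "HOL-Analysis.Analysis"
    "HOL-Library.Poly_Mapping"
    "HOL-Library.Log_Nat"
    "HOL-Computational_Algebra.Computational_Algebra"
begin

section \<open>Polynomial rings and ideals\<close>

text \<open>
  For a finite index type \<open>'m\<close>, the type \<open>('m \<Rightarrow>\<^sub>0 nat) \<Rightarrow>\<^sub>0 'k\<close> (finitely supported functions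
  with the convolution product) is the polynomial ring over \<open>'k\<close> in the variables \<open>x\<^sub>i\<close>, \<open>i :: 'm\<close>.
\<close>

type_synonym ('m, 'k) mpoly = "('m \<Rightarrow>\<^sub>0 nat) \<Rightarrow>\<^sub>0 'k"

definition monomial :: "nat ^ 'm \<Rightarrow> ('m::finite, 'k::field) mpoly" where
  "monomial a = Poly_Mapping.single (Abs_poly_mapping (\<lambda>i. a $ i)) 1"

text \<open>Ideals are the submodules of the ring, viewed as a module over itself.\<close>

definition is_ideal :: "'a::comm_ring_1 set \<Rightarrow> bool" where
  "is_ideal J \<longleftrightarrow> module.subspace (*) J"

definition ideal_gen :: "'a::comm_ring_1 set \<Rightarrow> 'a set" where
  "ideal_gen G = module.span (*) G"

definition ideal_mult :: "'a::comm_ring_1 set \<Rightarrow> 'a set \<Rightarrow> 'a set" where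
  "ideal_mult I J = ideal_gen {f * g | f g. f \<in> I \<and> g \<in> J}"

primrec ideal_power :: "'a::comm_ring_1 set \<Rightarrow> nat \<Rightarrow> 'a set" where
  "ideal_power I 0 = UNIV"
| "ideal_power I (Suc k) = ideal_mult I (ideal_power I k)"

definition F_finite :: "'k::field itself \<Rightarrow> bool" where
  "F_finite _ \<longleftrightarrow> (\<exists>B :: 'k set. finite B \<and>
     (\<forall>x. \<exists>c. (\<forall>b\<in>B. c b \<in> range (\<lambda>y. y ^ CHAR('k))) \<and> x = (\<Sum>b\<in>B. c b * b)))"


section \<open>Frobenius powers\<close>

text \<open>The parameter \<open>q\<close> in the next two definitions is meant to be a power of the characteristic.\<close>

definition frob_power :: "nat \<Rightarrow> 'a::comm_ring_1 set \<Rightarrow> 'a set" where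
  "frob_power q J = ideal_gen {f ^ q | f. f \<in> J}"

definition frob_root :: "nat \<Rightarrow> 'a::comm_ring_1 set \<Rightarrow> 'a set" where
  "frob_root q J = (LEAST L. is_ideal L \<and> J \<subseteq> frob_power q L)"

text \<open>
  \<open>I\<^bsup>[k]\<^esup>\<close>: the \<open>i\<close>-th base \<open>p\<close> digit of \<open>k\<close> is \<open>k div p ^ i mod p\<close>, and \<open>floorlog p k\<close> is the
  number of digits.
\<close>

definition frob_int :: "nat \<Rightarrow> 'a::comm_ring_1 set \<Rightarrow> nat \<Rightarrow> 'a set" where
  "frob_int p I k =
     foldr (\<lambda>i. ideal_mult (frob_power (p ^ i) (ideal_power I (k div p ^ i mod p))))
       [0..<floorlog p k] UNIV"

text \<open>\<open>I\<^bsup>[k/q]\<^esup>\<close> for \<open>q = p ^ e\<close>\<close>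

definition frob_rat :: "nat \<Rightarrow> 'a::comm_ring_1 set \<Rightarrow> nat \<Rightarrow> nat \<Rightarrow> 'a set" where
  "frob_rat p I k e = frob_root (p ^ e) (frob_int p I k)"

text \<open>
  \<open>I\<^bsup>[\<lambda>]\<^esup>\<close> for real \<open>\<lambda>\<close>: the common stable value along all sequences \<open>k\<^sub>j / p ^ e\<^sub>j\<close> decreasing
  (not necessarily strictly) to \<open>\<lambda>\<close>.
\<close>

definition frob_real :: "nat \<Rightarrow> 'a::comm_ring_1 set \<Rightarrow> real \<Rightarrow> 'a set" where
  "frob_real p I lam = (THE L. \<forall>k e :: nat \<Rightarrow> nat.
     decseq (\<lambda>j. real (k j) / real p ^ e j) \<longrightarrow>
     (\<forall>j. lam \<le> real (k j) / real p ^ e j) \<longrightarrow>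
     (\<lambda>j. real (k j) / real p ^ e j) \<longlonglongrightarrow> lam \<longrightarrow>
     (\<forall>\<^sub>F j in sequentially. frob_rat p I (k j) (e j) = L))"

definition crit_exponent :: "nat \<Rightarrow> ('m::finite, 'k::field) mpoly set \<Rightarrow> nat ^ 'm \<Rightarrow> real" where
  "crit_exponent p I b = Sup {lam. 0 \<le> lam \<and> monomial b \<in> frob_real p I lam}"


section \<open>Vectors, base \<open>p\<close> digits and witnesses\<close>

definition vec_sum :: "'a::comm_monoid_add ^ 'n \<Rightarrow> 'a" where
  "vec_sum u = (\<Sum>i\<in>UNIV. u $ i)"

definition prec :: "'a::ord ^ 'n \<Rightarrow> 'a ^ 'n \<Rightarrow> bool" (infix \<open>\<prec>\<close> 50) where
  "u \<prec> v \<longleftrightarrow> (\<forall>i. u $ i < v $ i)"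

definition real_vec :: "nat ^ 'n \<Rightarrow> real ^ 'n" where
  "real_vec v = (\<chi> i. real (v $ i))"

text \<open>
  Place \<open>j\<close> carries weight \<open>1 / p ^ j\<close>, so place \<open>0\<close> is the last place before the point.
  For a terminating decimal this is the digit in its terminating expansion.
\<close>

definition digit :: "nat \<Rightarrow> real \<Rightarrow> nat \<Rightarrow> nat" where
  "digit p u j = nat \<lfloor>u * real p ^ j\<rfloor> mod p"

text \<open>The vectors with entries in \<open>(1 / p ^ e) \<nat>\<close>\<close>

definition grid :: "nat \<Rightarrow> nat \<Rightarrow> (real ^ 'n) set" where
  "grid p e = {u. \<forall>i. \<exists>k::nat. u $ i = real k / real p ^ e}"

definition no_carry_vectors :: "nat \<Rightarrow> (real ^ 'n) set" where
  "no_carry_vectors p = {u.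
     (\<forall>i. 0 \<le> u $ i \<and> u $ i \<le> 1 \<and> (\<exists>k e. u $ i = real k / real p ^ e)) \<and>
     (\<forall>j. (\<Sum>i\<in>UNIV. digit p (u $ i) j) < p)}"

text \<open>\<open>v\<close> is an \<open>e\<close>-witness for \<open>lam\<close>\<close>

definition witness ::
    "nat \<Rightarrow> nat ^ 'n ^ 'm \<Rightarrow> nat ^ 'm \<Rightarrow> real \<Rightarrow> nat \<Rightarrow> real ^ 'n \<Rightarrow> bool" where
  "witness p A b lam e v \<longleftrightarrow>
     v \<in> no_carry_vectors p \<inter> grid p e \<and>
     map_matrix real A *v v \<prec> real_vec b + 1 \<and>
     lam - 1 / real p ^ e \<le> vec_sum v \<and> vec_sum v < lam"

definition convergent_witnesses ::
    "nat \<Rightarrow> nat ^ 'n ^ 'm \<Rightarrow> nat ^ 'm \<Rightarrow> real \<Rightarrow> (nat \<Rightarrow> real ^ 'n) \<Rightarrow> bool" where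
  "convergent_witnesses p A b lam v \<longleftrightarrow>
     (\<forall>e. witness p A b lam e (v e)) \<and>
     (\<forall>e i. \<forall>j\<le>e. digit p (v (Suc e) $ i) j = digit p (v e $ i) j)"


section \<open>Digit expansions\<close>

text \<open>
  A vector of formal expansions: \<open>d $ i\<close> stands for \<open>0.d\<^sub>1d\<^sub>2\<dots>\<close> with \<open>d\<^sub>j = (d $ i) j\<close>; the value
  at \<open>j = 0\<close> is not used. Keeping the digits matters for truncation, because an entry produced
  by the procedure may end in repeating digits \<open>p - 1\<close>.
\<close>

type_synonym 'n expansion = "(nat \<Rightarrow> nat) ^ 'n"

definition exp_value :: "nat \<Rightarrow> 'n::finite expansion \<Rightarrow> real ^ 'n" where
  "exp_value p d = (\<chi> i. suminf (\<lambda>j. real ((d $ i) (Suc j)) / real p ^ Suc j))"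

definition exp_trunc :: "nat \<Rightarrow> nat \<Rightarrow> 'n::finite expansion \<Rightarrow> real ^ 'n" where
  "exp_trunc p e d = (\<chi> i. \<Sum>j = 1..e. real ((d $ i) j) / real p ^ j)"

text \<open>The expansion with digits \<open>u\<^sub>1 \<dots> u\<^sub>c\<close> followed by the repeating block \<open>u\<^bsub>c+1\<^esub> \<dots> u\<^sub>e\<close>\<close>

definition repeating :: "nat \<Rightarrow> nat \<Rightarrow> nat \<Rightarrow> real ^ 'n \<Rightarrow> 'n::finite expansion" where
  "repeating p c e u = (\<chi> i. (\<lambda>j.
     digit p (u $ i) (if j \<le> c then j else Suc c + (j - Suc c) mod (e - c))))"


section \<open>The procedure\<close>

text \<open>
  \<open>\<L> e\<close> consists of pairs \<open>(u, [r\<^sub>0, \<dots>, r\<^bsub>e-1\<^esub>])\<close>. Indices are shifted by one with respect to a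
  description in which step \<open>e\<close> treats the pairs of \<open>\<L> (e - 1)\<close>: here the pairs in \<open>\<L> e\<close> are
  treated by computing \<open>r\<^sub>e\<close>, which yields \<open>\<L> (Suc e)\<close>.
\<close>

type_synonym ('n, 'm) state = "(real ^ 'n) \<times> (real ^ 'm) list"

definition residual ::
    "nat \<Rightarrow> int \<Rightarrow> nat ^ 'n ^ 'm \<Rightarrow> nat ^ 'm \<Rightarrow> nat \<Rightarrow> real ^ 'n \<Rightarrow> real ^ 'm" where
  "residual p \<Omega> A b e u =
     (\<chi> i. min (real_of_int \<Omega>) (real p ^ e * ((real_vec b + 1 - map_matrix real A *v u) $ i)))"

definition maximizers :: "nat \<Rightarrow> nat ^ 'n ^ 'm \<Rightarrow> real ^ 'm \<Rightarrow> (nat ^ 'n) set" where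
  "maximizers p A r =
     {v. is_arg_max vec_sum (\<lambda>v. real_vec (A *v v) \<prec> real p *\<^sub>R r \<and> vec_sum v < p) v}"

definition candidates ::
    "nat \<Rightarrow> int \<Rightarrow> nat ^ 'n ^ 'm \<Rightarrow> nat ^ 'm \<Rightarrow> nat \<Rightarrow>
     ('n, 'm) state set \<Rightarrow> ('n, 'm) state set" where
  "candidates p \<Omega> A b e L =
     {(u + (1 / real p ^ Suc e) *\<^sub>R real_vec v, R @ [residual p \<Omega> A b e u]) | u R v.
        (u, R) \<in> L \<and> residual p \<Omega> A b e u \<notin> set R \<and>
        v \<in> maximizers p A (residual p \<Omega> A b e u)}"

definition prune :: "('n::finite, 'm::finite) state set \<Rightarrow> ('n, 'm) state set" where
  "prune C = C - {(w, R). vec_sum w < Max ((\<lambda>(w, R). vec_sum w) ` C)}"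

primrec proc_list ::
    "nat \<Rightarrow> int \<Rightarrow> nat ^ 'n ^ 'm \<Rightarrow> nat ^ 'm \<Rightarrow> nat \<Rightarrow> ('n, 'm) state set" where
  "proc_list p \<Omega> A b 0 = {(0, [])}"
| "proc_list p \<Omega> A b (Suc e) = prune (candidates p \<Omega> A b e (proc_list p \<Omega> A b e))"

text \<open>The final value of the set \<open>\<Lambda>\<close>\<close>

definition proc_output ::
    "nat \<Rightarrow> int \<Rightarrow> nat ^ 'n ^ 'm \<Rightarrow> nat ^ 'm \<Rightarrow> 'n::finite expansion set" where
  "proc_output p \<Omega> A b =
     {repeating p c e u | c e u R.
        (u, R) \<in> proc_list p \<Omega> A b e \<and> c < e \<and> residual p \<Omega> A b e u = R ! c}"

end

theory Submission
  imports Defs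
begin

text \<open>
  Digit by digit, \<open>I\<^bsup>[k]\<^esup>\<close> is generated by the monomials \<open>x\<^bsup>A v\<^esup>\<close> with \<open>v\<close> free of carries and
  \<open>\<parallel>v\<parallel> = k\<close>, and the \<open>q\<close>-th root of a monomial ideal is obtained by taking floors of exponents
  divided by \<open>q\<close> (split off \<open>K\<^sup>q\<close> from \<open>K\<close> by a \<open>q\<^bsup>-1\<^esup>\<close>-linear functional). So the critical exponent is the
  supremum of \<open>\<parallel>v\<parallel> / p\<^sup>e\<close> over carry-free \<open>v\<close> with \<open>A v \<prec> p\<^sup>e (b + 1)\<close>, and it is not attained.

  The way in which such a \<open>v\<close> can be continued depends only on its residual cut off at \<open>\<Omega>\<close>, which takes
  finitely many values. Truncating a norm-maximal \<open>v\<close> of level \<open>E\<close> gives norm-maximal vectors of all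
  lower levels, so \<open>v\<close> survives all deletions until one of its residuals repeats. Deleting the block of
  digits between the two equal residuals leaves a feasible vector, whence repeating that block forever loses
  at most \<open>2 / p\<^sup>E\<close> against the supremum. As the output is finite and \<open>E\<close> arbitrary, its maximum is the
  supremum.
\<close>

no_notation fps_nth (infixl \<open>$\<close> 75)

subsection \<open>Monomial ideals\<close>

lemma module_ring: "module ((*) :: 'a::comm_ring_1 \<Rightarrow> 'a \<Rightarrow> 'a)"
  by unfold_locales (simp_all add: algebra_simps)

definition exponent :: "nat ^ 'm::finite \<Rightarrow> 'm \<Rightarrow>\<^sub>0 nat" where
  "exponent a = Abs_poly_mapping (\<lambda>i. a $ i)"

lemma lookup_exponent [simp]: "Poly_Mapping.lookup (exponent a) i = a $ i"
  by (simp add: exponent_def)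

lemma exponent_add: "exponent (a + b) = exponent a + exponent b"
  by (rule poly_mapping_eqI) (simp add: lookup_add)

lemma exponent_zero [simp]: "exponent 0 = 0"
  by (rule poly_mapping_eqI) simp

lemma monomial_eq_single: "monomial a = Poly_Mapping.single (exponent a) 1"
  by (simp add: monomial_def exponent_def)

lemma monomial_add: "monomial (a + b) = monomial a * monomial b"
  by (simp add: monomial_eq_single exponent_add mult_single)

lemma monomial_zero [simp]: "monomial 0 = 1"
  by (simp add: monomial_eq_single)

lemma monomial_scale: "monomial (q *s a) = monomial a ^ q"
proof (induction q)
  case 0
  have "0 *s a = 0" by (simp add: vec_eq_iff)
  then show ?case by simp
next
  case (Suc q)
  have "Suc q *s a = a + q *s a" by (simp add: vec_eq_iff)
  then show ?case by (simp add: monomial_add Suc)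
qed

lemma is_ideal_ideal_gen [simp]: "is_ideal (ideal_gen G)"
  by (simp add: is_ideal_def ideal_gen_def module.subspace_span[OF module_ring])

lemma ideal_gen_subset: "is_ideal J \<Longrightarrow> G \<subseteq> J \<Longrightarrow> ideal_gen G \<subseteq> J"
  by (simp add: is_ideal_def ideal_gen_def module.span_minimal[OF module_ring])

lemma ideal_gen_base: "g \<in> G \<Longrightarrow> g \<in> ideal_gen G"
  by (simp add: ideal_gen_def module.span_base[OF module_ring])

lemma is_ideal_0: "is_ideal J \<Longrightarrow> 0 \<in> J"
  and is_ideal_add: "is_ideal J \<Longrightarrow> f \<in> J \<Longrightarrow> g \<in> J \<Longrightarrow> f + g \<in> J"
  and is_ideal_mult: "is_ideal J \<Longrightarrow> f \<in> J \<Longrightarrow> h * f \<in> J"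
  by (simp_all add: is_ideal_def module.subspace_def[OF module_ring])

lemma is_idealI:
  "0 \<in> J \<Longrightarrow> (\<And>f g. f \<in> J \<Longrightarrow> g \<in> J \<Longrightarrow> f + g \<in> J) \<Longrightarrow> (\<And>h f. f \<in> J \<Longrightarrow> h * f \<in> J)
    \<Longrightarrow> is_ideal J"
  by (simp add: is_ideal_def module.subspace_def[OF module_ring])

definition mon_ideal :: "(nat ^ 'm) set \<Rightarrow> ('m::finite, 'k::field) mpoly set" where
  "mon_ideal E = ideal_gen (monomial ` E)"

lemma is_ideal_mon_ideal [simp]: "is_ideal (mon_ideal E)"
  by (simp add: mon_ideal_def)

lemma mon_ideal_subset: "is_ideal J \<Longrightarrow> (\<And>a. a \<in> E \<Longrightarrow> monomial a \<in> J) \<Longrightarrow> mon_ideal E \<subseteq> J"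
  unfolding mon_ideal_def by (rule ideal_gen_subset) auto

text \<open>The polynomials all of whose terms are divisible by a generator form an ideal containing
  the generators, hence containing \<open>mon_ideal E\<close>.\<close>

lemma keys_mon_ideal:
  fixes f :: "('m::finite, 'k::field) mpoly"
  assumes "f \<in> mon_ideal E" "t \<in> Poly_Mapping.keys f"
  shows "\<exists>a\<in>E. \<forall>i. a $ i \<le> Poly_Mapping.lookup t i"
proof -
  define J where "J = {f :: ('m, 'k) mpoly. \<forall>t\<in>Poly_Mapping.keys f. \<exists>a\<in>E. \<forall>i. a $ i \<le> Poly_Mapping.lookup t i}"
  have "is_ideal J"
  proof (rule is_idealI)
    show "0 \<in> J" by (simp add: J_def)
    show "f + g \<in> J" if "f \<in> J" "g \<in> J" for f g
      using that Poly_Mapping.keys_add[of f g] by (auto simp: J_def)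
    show "h * f \<in> J" if "f \<in> J" for h f
    proof -
      have "\<exists>a\<in>E. \<forall>i. a $ i \<le> Poly_Mapping.lookup t i" if t: "t \<in> Poly_Mapping.keys (h * f)" for t
      proof -
        from t obtain u v where uv: "t = u + v" "v \<in> Poly_Mapping.keys f"
          using Poly_Mapping.keys_mult[of h f] by blast
        with \<open>f \<in> J\<close> obtain a where "a \<in> E" "\<forall>i. a $ i \<le> Poly_Mapping.lookup v i" by (auto simp: J_def)
        then show ?thesis by (auto simp: uv lookup_add intro: trans_le_add2)
      qed
      then show ?thesis by (auto simp: J_def)
    qed
  qed
  moreover have "monomial a \<in> J" if "a \<in> E" for a
    using that by (auto simp: J_def monomial_eq_single)
  ultimately have "mon_ideal E \<subseteq> J" by (rule mon_ideal_subset)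
  with assms show ?thesis by (auto simp: J_def)
qed

lemma is_ideal_monomial_mono:
  assumes "is_ideal J" "monomial a \<in> J" "\<And>i. a $ i \<le> c $ i"
  shows "monomial c \<in> J"
proof -
  have "c = (c - a) + a" using assms(3) by (simp add: vec_eq_iff)
  then show ?thesis using assms(1,2) by (metis is_ideal_mult monomial_add)
qed

lemma mon_ideal_base: "a \<in> E \<Longrightarrow> monomial a \<in> mon_ideal E"
  unfolding mon_ideal_def by (intro ideal_gen_base imageI)

lemma monomial_in_mon_ideal_iff:
  "monomial c \<in> mon_ideal E \<longleftrightarrow> (\<exists>a\<in>E. \<forall>i. a $ i \<le> c $ i)"
proof
  assume *: "monomial c \<in> mon_ideal E"
  show "\<exists>a\<in>E. \<forall>i. a $ i \<le> c $ i"
    using keys_mon_ideal[OF *, of "exponent c"] by (simp add: monomial_eq_single)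
next
  assume "\<exists>a\<in>E. \<forall>i. a $ i \<le> c $ i"
  then obtain a where "a \<in> E" "\<And>i. a $ i \<le> c $ i" by blast
  then show "monomial c \<in> mon_ideal E"
    by (intro is_ideal_monomial_mono[OF is_ideal_mon_ideal mon_ideal_base])
qed

lemma mon_ideal_UNIV: "(mon_ideal {0} :: ('m::finite, 'k::field) mpoly set) = UNIV"
proof -
  have "1 \<in> (mon_ideal {0} :: ('m, 'k) mpoly set)"
    using mon_ideal_base[of 0 "{0}"] unfolding monomial_zero by blast
  then have "h * 1 \<in> (mon_ideal {0} :: ('m, 'k) mpoly set)" for h
    by (rule is_ideal_mult[OF is_ideal_mon_ideal])
  then show ?thesis unfolding mult_1_right by (intro UNIV_eq_I[symmetric])
qed

text \<open>With one factor fixed, the other factors whose product lies in the target form an ideal.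
  So it is enough to test generators, first on one side and then on the other.\<close>

lemma ideal_mult_mon_ideal:
  "ideal_mult (mon_ideal E) (mon_ideal F) = mon_ideal {a + b | a b. a \<in> E \<and> b \<in> F}"
    (is "?L = mon_ideal ?G")
proof
  have *: "f * g \<in> mon_ideal ?G" if "f \<in> mon_ideal E" "g \<in> mon_ideal F" for f g :: "('a, 'b) mpoly"
  proof -
    have 1: "f * monomial b \<in> mon_ideal ?G" if "f \<in> mon_ideal E" "b \<in> F" for f :: "('a, 'b) mpoly" and b
    proof -
      have "is_ideal {f. f * monomial b \<in> (mon_ideal ?G :: ('a, 'b) mpoly set)}"
        by (rule is_idealI)
           (auto simp: is_ideal_0 distrib_right mult.assoc intro: is_ideal_add is_ideal_mult)
      then have "mon_ideal E \<subseteq> {f. f * monomial b \<in> (mon_ideal ?G :: ('a, 'b) mpoly set)}"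
        using that by (intro mon_ideal_subset) (auto simp flip: monomial_add intro!: mon_ideal_base)
      then show ?thesis using that by auto
    qed
    have "is_ideal {g. f * g \<in> (mon_ideal ?G :: ('a, 'b) mpoly set)}"
      by (rule is_idealI)
         (auto simp: is_ideal_0 distrib_left mult.left_commute intro: is_ideal_add is_ideal_mult)
    then have "mon_ideal F \<subseteq> {g. f * g \<in> (mon_ideal ?G :: ('a, 'b) mpoly set)}"
      using 1[OF that(1)] by (intro mon_ideal_subset) auto
    then show ?thesis using that by auto
  qed
  show "?L \<subseteq> mon_ideal ?G"
    unfolding ideal_mult_def by (rule ideal_gen_subset) (auto intro: *)
  show "mon_ideal ?G \<subseteq> ?L"
    unfolding ideal_mult_def
    by (rule mon_ideal_subset)
       (auto simp: monomial_add intro!: ideal_gen_base, blast intro: mon_ideal_base)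
qed


subsection \<open>Frobenius powers and roots of monomial ideals\<close>

text \<open>The field embeds as the constants. This makes the additivity of \<open>q\<close>-th
  powers available in the polynomial ring.\<close>

lemma CHAR_poly_mapping [simp]: "CHAR('a::comm_monoid_add \<Rightarrow>\<^sub>0 'k::comm_semiring_1) = CHAR('k)"
proof (rule CHAR_eqI)
  show "of_nat CHAR('k) = (0 :: 'a \<Rightarrow>\<^sub>0 'k)"
    by (simp flip: single_of_nat)
  show "CHAR('k) dvd n" if "of_nat n = (0 :: 'a \<Rightarrow>\<^sub>0 'k)" for n
  proof -
    have "Poly_Mapping.lookup (of_nat n :: 'a \<Rightarrow>\<^sub>0 'k) 0 = 0" using that by simp
    then have "of_nat n = (0 :: 'k)" by (simp add: lookup_of_nat)
    then show ?thesis by (simp add: of_nat_eq_0_iff_char_dvd)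
  qed
qed

lemma mpoly_freshmans_dream:
  fixes f g :: "('m, 'k::field) mpoly"
  assumes "prime CHAR('k)" "q = CHAR('k) ^ e"
  shows "(f + g) ^ q = f ^ q + g ^ q"
  by (rule freshmans_dream') (simp_all add: assms)

text \<open>Since \<open>q\<close>-th powers are additive, the \<open>f\<close> whose
  \<open>q\<close>-th power lies in the right-hand side form an ideal, so the generators
  suffice.\<close>

lemma frob_power_mon_ideal:
  assumes "prime CHAR('k::field)" and q: "q = CHAR('k) ^ e"
  shows "frob_power q (mon_ideal E :: ('m::finite, 'k) mpoly set) = mon_ideal ((*s) q ` E)"
proof
  have "q > 0" using assms prime_gt_0_nat by simp
  have "is_ideal {f. f ^ q \<in> (mon_ideal ((*s) q ` E) :: ('m, 'k) mpoly set)}"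
  proof (rule is_idealI)
    show "0 \<in> {f. f ^ q \<in> (mon_ideal ((*s) q ` E) :: ('m, 'k) mpoly set)}"
      using \<open>q > 0\<close> by (simp add: is_ideal_0 power_0_left)
  qed (simp_all add: mpoly_freshmans_dream[OF assms] power_mult_distrib is_ideal_add is_ideal_mult)
  moreover have "monomial a ^ q \<in> (mon_ideal ((*s) q ` E) :: ('m, 'k) mpoly set)" if "a \<in> E" for a
    unfolding monomial_scale[symmetric] using that by (intro mon_ideal_base imageI)
  ultimately have "mon_ideal E \<subseteq> {f. f ^ q \<in> (mon_ideal ((*s) q ` E) :: ('m, 'k) mpoly set)}"
    by (intro mon_ideal_subset) simp_all
  then show "frob_power q (mon_ideal E) \<subseteq> (mon_ideal ((*s) q ` E) :: ('m, 'k) mpoly set)"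
    unfolding frob_power_def by (intro ideal_gen_subset) auto
  have "monomial (q *s a) \<in> frob_power q (mon_ideal E :: ('m, 'k) mpoly set)" if "a \<in> E" for a
  proof -
    have "monomial a \<in> (mon_ideal E :: ('m, 'k) mpoly set)" using that by (rule mon_ideal_base)
    then show ?thesis
      unfolding frob_power_def monomial_scale by (intro ideal_gen_base) blast
  qed
  moreover have "is_ideal (frob_power q (mon_ideal E :: ('m, 'k) mpoly set))"
    by (simp add: frob_power_def)
  ultimately show "(mon_ideal ((*s) q ` E) :: ('m, 'k) mpoly set) \<subseteq> frob_power q (mon_ideal E)"
    by (intro mon_ideal_subset) blast+
qed

lemma poly_mapping_add_induct [case_names zero single add]:
  assumes "P 0" "\<And>t x. P (Poly_Mapping.single t x)" "\<And>f g. P f \<Longrightarrow> P g \<Longrightarrow> P (f + g)"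
  shows "P f"
proof (induction f rule: update_induct)
  case const
  then show ?case by (rule assms)
next
  case (update f a b)
  then have "Poly_Mapping.update a b f = Poly_Mapping.single a b + f"
    by (intro poly_mapping_eqI) (auto simp: lookup_update lookup_add lookup_single when_def in_keys_iff)
  with update assms(2,3) show ?case by simp
qed

text \<open>With scalars acting by \<open>c ^ q * x\<close> the field is a vector space over itself
  in which \<open>{1}\<close> is independent. A linear functional extending \<open>1\<close> to
  \<open>1\<close> is the required map.\<close>

lemma ex_frobenius_splitting:
  assumes "prime CHAR('k::field)" and q: "q = CHAR('k) ^ e"
  shows "\<exists>\<phi> :: 'k \<Rightarrow> 'k. \<phi> 1 = 1 \<and> (\<forall>x y. \<phi> (x + y) = \<phi> x + \<phi> y) \<and> (\<forall>x y. \<phi> (x * y ^ q) = \<phi> x * y)"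
proof -
  interpret s: vector_space "\<lambda>c x :: 'k. c ^ q * x"
    using assms by unfold_locales (simp_all add: algebra_simps freshmans_dream' power_mult_distrib)
  interpret vector_space_pair "\<lambda>c x :: 'k. c ^ q * x" "(*) :: 'k \<Rightarrow> 'k \<Rightarrow> 'k"
    by unfold_locales (simp_all add: algebra_simps)
  have ind: "s.independent {1}" by simp
  let ?\<phi> = "construct {1} (\<lambda>x. x)"
  interpret \<phi>: Vector_Spaces.linear "\<lambda>c x :: 'k. c ^ q * x" "(*)" ?\<phi>
    using linear_construct[OF ind] .
  have "?\<phi> (x + y) = ?\<phi> x + ?\<phi> y" "?\<phi> (y ^ q * x) = y * ?\<phi> x" for x y
    by (rule \<phi>.add, rule \<phi>.scale)
  moreover have "?\<phi> 1 = 1" using construct_basis[OF ind] by simp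
  ultimately show ?thesis by (intro exI[of _ ?\<phi>]) (simp add: mult.commute)
qed

text \<open>The splitting of the field extends to an additive operator on polynomials that keeps
  only exponents congruent to \<open>a\<close> modulo \<open>q\<close> and divides them by
  \<open>q\<close>. It cancels \<open>q\<close>-th powers, so it maps \<open>frob_power q L\<close>
  into \<open>L\<close>.\<close>

lemma monomial_frob_power_div:
  fixes L :: "('m::finite, 'k::field) mpoly set"
  assumes pr: "prime CHAR('k)" and q: "q = CHAR('k) ^ e"
    and L: "is_ideal L" and a: "monomial a \<in> frob_power q L"
  shows "monomial (\<chi> i. a $ i div q) \<in> L"
proof -
  have q0: "q > 0" using pr q prime_gt_0_nat by simp
  obtain \<phi> :: "'k \<Rightarrow> 'k" where \<phi>: "\<phi> 1 = 1" "\<And>x y. \<phi> (x + y) = \<phi> x + \<phi> y" "\<And>x y. \<phi> (x * y ^ q) = \<phi> x * y"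
    using ex_frobenius_splitting[OF pr q] by blast
  have \<phi>0: "\<phi> 0 = 0" by (metis \<phi>(2) add_0 add_cancel_right_right)
  define r where "r i = a $ i mod q" for i
  define up :: "('m \<Rightarrow>\<^sub>0 nat) \<Rightarrow> ('m \<Rightarrow>\<^sub>0 nat)" where
    "up s = exponent (\<chi> i. q * Poly_Mapping.lookup s i + r i)" for s
  have lookup_up: "Poly_Mapping.lookup (up s) i = q * Poly_Mapping.lookup s i + r i" for s i
    by (simp add: up_def)
  have inj_up: "inj up"
  proof (rule injI)
    fix s t assume "up s = up t"
    then have "Poly_Mapping.lookup (up s) i = Poly_Mapping.lookup (up t) i" for i by simp
    then show "s = t" using q0 by (intro poly_mapping_eqI) (simp add: lookup_up)
  qed
  \<comment> \<open>\<open>\<Phi> (h f\<^sup>q) = \<Phi> h f\<close>, and \<open>\<Phi>\<close> sends \<open>x\<^sup>a\<close> to the monomial in the claim.\<close>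
  define \<Phi> :: "('m, 'k) mpoly \<Rightarrow> ('m, 'k) mpoly" where
    "\<Phi> h = Abs_poly_mapping (\<lambda>s. \<phi> (Poly_Mapping.lookup h (up s)))" for h
  have lookup_\<Phi>: "Poly_Mapping.lookup (\<Phi> h) s = \<phi> (Poly_Mapping.lookup h (up s))" for h s
  proof -
    have "{s. \<phi> (Poly_Mapping.lookup h (up s)) \<noteq> 0} \<subseteq> up -` Poly_Mapping.keys h"
      using \<phi>0 by (auto simp: in_keys_iff)
    then have "finite {s. \<phi> (Poly_Mapping.lookup h (up s)) \<noteq> 0}"
      using finite_vimageI[OF finite_keys inj_up] finite_subset by blast
    then show ?thesis by (simp add: \<Phi>_def)
  qed
  have \<Phi>_add: "\<Phi> (f + g) = \<Phi> f + \<Phi> g" for f g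
    by (rule poly_mapping_eqI) (simp add: lookup_\<Phi> lookup_add \<phi>)
  have \<Phi>_0: "\<Phi> 0 = 0"
    by (rule poly_mapping_eqI) (simp add: lookup_\<Phi> \<phi>0)
  have single_power: "Poly_Mapping.single s y ^ q = Poly_Mapping.single (exponent (\<chi> i. q * Poly_Mapping.lookup s i)) (y ^ q)"
    for s :: "'m \<Rightarrow>\<^sub>0 nat" and y :: 'k
  proof -
    have "Poly_Mapping.single s y ^ n = Poly_Mapping.single (exponent (\<chi> i. n * Poly_Mapping.lookup s i)) (y ^ n)" for n
    proof (induction n)
      case 0
      have "exponent (\<chi> i. 0 * Poly_Mapping.lookup s i) = 0" by (rule poly_mapping_eqI) simp
      then show ?case by simp
    next
      case (Suc n)
      have "exponent (\<chi> i. Suc n * Poly_Mapping.lookup s i) = s + exponent (\<chi> i. n * Poly_Mapping.lookup s i)"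
        by (rule poly_mapping_eqI) (simp add: lookup_add)
      then show ?case by (simp add: Suc mult_single)
    qed
    then show ?thesis .
  qed
  have \<Phi>_single: "\<Phi> (Poly_Mapping.single t x * Poly_Mapping.single s y ^ q)
      = \<Phi> (Poly_Mapping.single t x) * Poly_Mapping.single s y" for t s x y
  proof (cases "\<exists>u. up u = t")
    case True
    then obtain u where u: "up u = t" by blast
    have "exponent (\<chi> i. q * Poly_Mapping.lookup s i) + t = up (s + u)"
      by (rule poly_mapping_eqI) (simp add: lookup_up lookup_add algebra_simps flip: u)
    moreover have "\<Phi> (Poly_Mapping.single (up u) x) = Poly_Mapping.single u (\<phi> x)" for u x
      by (rule poly_mapping_eqI) (auto simp: lookup_\<Phi> lookup_single when_def \<phi>0 dest: injD[OF inj_up])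
    ultimately show ?thesis
      by (simp add: single_power mult_single add.commute \<phi> flip: u)
  next
    case False
    \<comment> \<open>Multiplying by a \<open>q\<close>-th power does not change exponents modulo
      \<open>q\<close>. If \<open>t\<close> is in the wrong residue class, so is the product, and
      both sides vanish.\<close>
    have "up v \<noteq> t + exponent (\<chi> i. q * Poly_Mapping.lookup s i)" for v
    proof
      assume eq: "up v = t + exponent (\<chi> i. q * Poly_Mapping.lookup s i)"
      have eq': "q * Poly_Mapping.lookup v i + r i = Poly_Mapping.lookup t i + q * Poly_Mapping.lookup s i" for i
        using arg_cong[OF eq, of "\<lambda>t. Poly_Mapping.lookup t i"] by (simp add: lookup_up lookup_add)
      have "Poly_Mapping.lookup t i mod q = r i" for i
      proof -
        have "(q * Poly_Mapping.lookup v i + r i) mod q = (Poly_Mapping.lookup t i + q * Poly_Mapping.lookup s i) mod q" using eq' by simp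
        then show ?thesis by (simp add: r_def)
      qed
      then have "up (exponent (\<chi> i. Poly_Mapping.lookup t i div q)) = t"
        by (intro poly_mapping_eqI) (metis lookup_up lookup_exponent vec_lambda_beta mult_div_mod_eq)
      with False show False by blast
    qed
    then have "\<Phi> (Poly_Mapping.single t x * Poly_Mapping.single s y ^ q) = 0"
      by (intro poly_mapping_eqI)
         (simp add: single_power mult_single lookup_\<Phi> lookup_single_not_eq[OF not_sym] \<phi>0)
    moreover have "\<Phi> (Poly_Mapping.single t x) = 0"
      using False by (intro poly_mapping_eqI) (auto simp: lookup_\<Phi> lookup_single when_def \<phi>0)
    ultimately show ?thesis by simp
  qed
  have \<Phi>_1: "\<Phi> (h * Poly_Mapping.single s y ^ q) = \<Phi> h * Poly_Mapping.single s y" for h s y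
    by (induction h rule: poly_mapping_add_induct)
       (simp_all add: \<Phi>_0 \<Phi>_single \<Phi>_add distrib_right)
  have \<Phi>_mult: "\<Phi> (h * f ^ q) = \<Phi> h * f" for h f
    by (induction f rule: poly_mapping_add_induct)
       (use q0 in \<open>simp_all add: \<Phi>_0 \<Phi>_1 \<Phi>_add distrib_left mpoly_freshmans_dream[OF pr q] power_0_left\<close>)
  \<comment> \<open>\<open>\<Phi>\<close> is not linear over the ring; quantifying over all
    multipliers \<open>h\<close> is what makes this set closed under multiplication.\<close>
  have "is_ideal {g. \<forall>h. \<Phi> (h * g) \<in> L}"
    by (rule is_idealI)
       (auto simp: is_ideal_0 L \<Phi>_0 \<Phi>_add distrib_left is_ideal_add simp flip: mult.assoc)
  moreover have "{f ^ q | f. f \<in> L} \<subseteq> {g. \<forall>h. \<Phi> (h * g) \<in> L}"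
    by (auto simp: \<Phi>_mult L is_ideal_mult)
  ultimately have "frob_power q L \<subseteq> {g. \<forall>h. \<Phi> (h * g) \<in> L}"
    unfolding frob_power_def by (rule ideal_gen_subset)
  with a have "\<Phi> (1 * monomial a) \<in> L" by blast
  moreover have "\<Phi> (monomial a) = monomial (\<chi> i. a $ i div q)"
  proof -
    have "exponent a = up s \<longleftrightarrow> exponent (\<chi> i. a $ i div q) = s" for s
    proof -
      have "up (exponent (\<chi> i. a $ i div q)) = exponent a"
        by (rule poly_mapping_eqI) (simp add: lookup_up r_def)
      then show ?thesis using inj_up by (metis injD)
    qed
    then show ?thesis
      by (intro poly_mapping_eqI) (simp add: lookup_\<Phi> monomial_eq_single lookup_single when_def \<phi>(1) \<phi>0)
  qed
  ultimately show ?thesis by simp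
qed

text \<open>The inequality says \<open>a $ i div q \<le> c $ i\<close> without division. The root
  must contain these monomials by \<open>monomial_frob_power_div\<close>, and they suffice because
  \<open>x^a\<close> is a multiple of the \<open>q\<close>-th power of
  \<open>x^(a div q)\<close>.\<close>

lemma frob_root_mon_ideal:
  assumes pr: "prime CHAR('k::field)" and q: "q = CHAR('k) ^ e"
  shows "frob_root q (mon_ideal E :: ('m::finite, 'k) mpoly set)
    = mon_ideal {c. \<exists>a\<in>E. \<forall>i. a $ i < q * (c $ i + 1)}" (is "_ = mon_ideal ?F")
proof -
  have q0: "q > 0" using pr q prime_gt_0_nat by simp
  have "(mon_ideal E :: ('m, 'k) mpoly set) \<subseteq> mon_ideal ((*s) q ` ?F)"
  proof (rule mon_ideal_subset)
    fix a assume "a \<in> E"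
    moreover have "a $ i < q * ((\<chi> i. a $ i div q) $ i + 1)" for i
      using q0 dividend_less_times_div[of q "a $ i"] by simp
    ultimately have "(\<chi> i. a $ i div q) \<in> ?F" by blast
    then have "q *s (\<chi> i. a $ i div q) \<in> (*s) q ` ?F" by (rule imageI)
    then show "monomial a \<in> (mon_ideal ((*s) q ` ?F) :: ('m, 'k) mpoly set)"
      unfolding monomial_in_mon_ideal_iff by (rule bexI[rotated]) simp
  qed (rule is_ideal_mon_ideal)
  then have 1: "is_ideal (mon_ideal ?F) \<and> (mon_ideal E :: ('m, 'k) mpoly set) \<subseteq> frob_power q (mon_ideal ?F)"
    unfolding frob_power_mon_ideal[OF assms] by (intro conjI is_ideal_mon_ideal)
  have "mon_ideal ?F \<subseteq> L" if L: "is_ideal L" "mon_ideal E \<subseteq> frob_power q L" for L :: "('m, 'k) mpoly set"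
  proof (rule mon_ideal_subset)
    fix c assume "c \<in> ?F"
    then obtain a where a: "a \<in> E" "\<And>i. a $ i < q * (c $ i + 1)" by blast
    then have "monomial (\<chi> i. a $ i div q) \<in> L"
      using monomial_frob_power_div[OF assms L(1)] L(2) mon_ideal_base by blast
    moreover have "(\<chi> i. a $ i div q) $ i \<le> c $ i" for i
      using less_mult_imp_div_less[of "a $ i" "c $ i + 1" q] a(2)[of i] by (simp add: mult.commute)
    ultimately show "monomial c \<in> L"
      using is_ideal_monomial_mono[OF L(1)] by blast
  qed (use L in blast)
  with 1 show ?thesis
    unfolding frob_root_def by (intro Least_equality) blast+
qed

subsection \<open>Carry-free vectors\<close>

lemma vec_sum_0 [simp]: "vec_sum 0 = 0"
  and vec_sum_add: "vec_sum (u + v) = vec_sum u + vec_sum v"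
  by (simp_all add: vec_sum_def sum.distrib)

lemma vec_sum_scale: "vec_sum (q *s u) = q * vec_sum (u :: nat ^ 'n)"
  by (simp add: vec_sum_def sum_distrib_left)

lemma vec_sum_axis [simp]: "vec_sum (axis j c) = c"
  by (simp add: vec_sum_def axis_def)

lemma axis_component: "axis j c $ i = (if i = j then c else 0)"
  by (simp add: axis_def)

lemma component_le_vec_sum: "u $ i \<le> vec_sum (u :: nat ^ 'n)"
  unfolding vec_sum_def by (rule member_le_sum) auto

lemma vec_sum_eq_0_iff: "vec_sum (u :: nat ^ 'n) = 0 \<longleftrightarrow> u = 0"
  by (simp add: vec_sum_def vec_eq_iff)

lemma vec_sum_mono: "(\<And>i. u $ i \<le> v $ i) \<Longrightarrow> vec_sum (u :: nat ^ 'n) \<le> vec_sum v"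
  unfolding vec_sum_def by (rule sum_mono)

lemma vec_sum_less_ex: "vec_sum u < vec_sum (v :: nat ^ 'n) \<Longrightarrow> \<exists>i. u $ i < v $ i"
  by (meson not_less vec_sum_mono)

lemma ex_vec_sum_eq:
  fixes d :: "nat ^ 'n"
  assumes "k \<le> vec_sum d"
  shows "\<exists>d'. vec_sum d' = k \<and> (\<forall>i. d' $ i \<le> d $ i)"
  using assms
proof (induction k)
  case 0
  show ?case by (rule exI[of _ 0]) simp
next
  case (Suc k)
  then obtain d' where d': "vec_sum d' = k" "\<forall>i. d' $ i \<le> d $ i" by auto
  with Suc.prems obtain i where "d' $ i < d $ i" using vec_sum_less_ex[of d' d] by auto
  with d' show ?case
    by (intro exI[of _ "d' + axis i 1"]) (auto simp: vec_sum_add axis_component)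
qed

lemma matrix_vector_scale: "A *v (q *s u) = q *s (A *v (u :: nat ^ 'n))"
  by (simp add: matrix_vector_mult_def vec_eq_iff sum_distrib_left mult.left_commute)

lemma matrix_vector_axis: "A *v axis j 1 = column j (A :: nat ^ 'n ^ 'm)"
  by (simp add: matrix_vector_mult_def vec_eq_iff column_def axis_component if_distrib cong: if_cong)

lemma matrix_vector_mono:
  "(\<And>i. u $ i \<le> v $ i) \<Longrightarrow> (A *v u) $ i \<le> (A *v (v :: nat ^ 'n)) $ i"
  by (simp add: matrix_vector_mult_def sum_mono)

lemma vec_scale_scale: "a *s (b *s u) = (a * b) *s (u :: nat ^ 'n)"
  by (simp add: vec_eq_iff)

lemma vec_scale_1 [simp]: "Suc 0 *s u = u"
  by (simp add: vec_eq_iff)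

lemma vec_scale_0 [simp]: "q *s 0 = (0 :: nat ^ 'n)"
  by (simp add: vec_eq_iff)

text \<open>\<open>d\<close> is the vector of the last base \<open>p\<close> digits of the components.\<close>

inductive carry_free :: "nat \<Rightarrow> nat ^ 'n::finite \<Rightarrow> bool" for p where
  zero: "carry_free p 0"
| step: "carry_free p u \<Longrightarrow> vec_sum d < p \<Longrightarrow> carry_free p (p *s u + d)"

lemma carry_free_scale:
  assumes "0 < p" "carry_free p u"
  shows "carry_free p (p ^ e *s u)"
proof (induction e)
  case (Suc e)
  have "p ^ Suc e *s u = p *s (p ^ e *s u) + 0" by (simp add: vec_eq_iff)
  then show ?case using carry_free.step[OF Suc, of 0] assms by simp
qed (use assms in simp)

text \<open>As \<open>vec_sum d < p\<close>, the norms of the leading part and of the last digits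
  are the quotient and the remainder of the total norm modulo \<open>p\<close>.\<close>

lemma carry_free_vec_sum_split:
  assumes "0 < p"
  shows "carry_free p w \<and> vec_sum w = k \<longleftrightarrow>
    (\<exists>v d. w = p *s v + d \<and> carry_free p v \<and> vec_sum v = k div p \<and> vec_sum d = k mod p)"
    (is "?L \<longleftrightarrow> ?R")
proof
  assume ?L
  then have "carry_free p w" and k: "vec_sum w = k" by auto
  then show ?R
  proof cases
    case zero
    with k show ?thesis by (intro exI[of _ 0]) (auto intro: carry_free.zero)
  next
    case (step u d)
    with k assms show ?thesis
      by (intro exI[of _ u] exI[of _ d]) (auto simp: vec_sum_add vec_sum_scale)
  qed
next
  assume ?R
  then show ?L
    using assms by (auto simp: vec_sum_add vec_sum_scale intro!: carry_free.step)
qed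

text \<open>If \<open>p\<close> divides the norm, the sum of the last digits is \<open>0\<close>, so
  every last digit is \<open>0\<close> and a factor \<open>p\<close> can be removed. This is
  repeated \<open>e\<close> times.\<close>

lemma carry_free_power_dvd:
  assumes "0 < p" "carry_free p w" "vec_sum w = p ^ e * k"
  shows "\<exists>u. w = p ^ e *s u \<and> carry_free p u \<and> vec_sum u = k"
  using assms(2,3)
proof (induction e arbitrary: w)
  case 0
  then show ?case by simp
next
  case (Suc e)
  then have "carry_free p w \<and> vec_sum w = p * (p ^ e * k)" by (simp add: mult.assoc)
  then obtain v d where v: "w = p *s v + d" "carry_free p v" "vec_sum v = p * (p ^ e * k) div p"
      "vec_sum d = p * (p ^ e * k) mod p"
    unfolding carry_free_vec_sum_split[OF assms(1)] by blast
  then have "d = 0" "vec_sum v = p ^ e * k"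
    using assms(1) by (simp_all add: vec_sum_eq_0_iff)
  with Suc.IH[of v] v show ?case by (auto simp: vec_scale_scale)
qed

text \<open>Compare \<open>k div p\<close> with the norm of the leading part \<open>u\<close>. If
  they agree, only the last digits have to be lowered; otherwise a smaller leading part leaves some
  coordinate a whole unit of room.\<close>

lemma carry_free_ex_le:
  assumes "0 < p" "carry_free p w" "k \<le> vec_sum w"
  shows "\<exists>w'. carry_free p w' \<and> vec_sum w' = k \<and> (\<forall>i. w' $ i \<le> w $ i)"
  using assms(2,3)
proof (induction arbitrary: k rule: carry_free.induct)
  case zero
  then show ?case by (auto intro: carry_free.zero)
next
  case (step u d)
  have k: "k \<le> p * vec_sum u + vec_sum d" using step.prems by (simp add: vec_sum_add vec_sum_scale)
  have "k div p \<le> (p * vec_sum u + vec_sum d) div p" using k by (rule div_le_mono)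
  then have le: "k div p \<le> vec_sum u" using step.hyps by simp
  have mod: "k mod p < p" using assms by simp
  show ?case
  proof (cases "k div p = vec_sum u")
    case True
    then have "k mod p \<le> vec_sum d" using k by (metis add_le_cancel_left mult_div_mod_eq)
    then obtain d' where "vec_sum d' = k mod p" "\<forall>i. d' $ i \<le> d $ i"
      using ex_vec_sum_eq by blast
    with True step.hyps mod show ?thesis
      by (intro exI[of _ "p *s u + d'"])
         (auto simp: vec_sum_add vec_sum_scale simp flip: True intro!: carry_free.step)
  next
    case False
    obtain u' where u': "carry_free p u'" "vec_sum u' = k div p" "\<And>i. u' $ i \<le> u $ i"
      using step.IH[OF le] by auto
    with False le obtain j where j: "u' $ j < u $ j" using vec_sum_less_ex[of u' u] by auto
    \<comment> \<open>There is room for all lower digits of \<open>k\<close> in the coordinate \<open>j\<close>.\<close>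
    define w' where "w' = p *s u' + axis j (k mod p)"
    have "w' $ i \<le> (p *s u + d) $ i" for i
    proof (cases "i = j")
      case True
      have "p * u' $ j + p \<le> p * u $ j"
        using mult_le_mono2[of "Suc (u' $ j)" "u $ j" p] j by simp
      with True mod show ?thesis by (simp add: w'_def axis_component)
    next
      case False
      then show ?thesis using u'(3)[of i] by (simp add: w'_def axis_component trans_le_add1)
    qed
    moreover have "carry_free p w'" "vec_sum w' = k"
      using u' mod by (auto simp: w'_def vec_sum_add vec_sum_scale intro!: carry_free.step)
    ultimately show ?thesis by blast
  qed
qed


subsection \<open>Frobenius powers of a monomial ideal\<close>

text \<open>Here \<open>v $ j\<close> counts how often generator \<open>j\<close> occurs in a
  product of \<open>k\<close> generators.\<close>

lemma ideal_power_column_ideal: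
  "ideal_power (mon_ideal (range (\<lambda>j. column j A))) k = mon_ideal {A *v v | v. vec_sum v = k}"
proof (induction k)
  case 0
  have "{A *v v | v. vec_sum v = 0} = {0}" by (auto simp: vec_sum_eq_0_iff)
  then show ?case by (simp add: mon_ideal_UNIV)
next
  case (Suc k)
  have "{a + b | a b. a \<in> range (\<lambda>j. column j A) \<and> b \<in> {A *v v | v. vec_sum v = k}}
      = {A *v v | v. vec_sum v = Suc k}" (is "?L = ?R")
  proof
    show "?L \<subseteq> ?R"
    proof
      fix c assume "c \<in> ?L"
      then obtain j v where "c = column j A + A *v v" "vec_sum v = k" by blast
      then have "c = A *v (axis j 1 + v)" "vec_sum v = k"
        by (simp_all only: matrix_vector_right_distrib matrix_vector_axis)
      then show "c \<in> ?R" by (auto simp: vec_sum_add intro!: exI[of _ "axis j 1 + v"])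
    qed
    show "?R \<subseteq> ?L"
    proof
      fix c assume "c \<in> ?R"
      then obtain v where v: "c = A *v v" "vec_sum v = Suc k" by auto
      then obtain j where j: "0 < v $ j" using vec_sum_less_ex[of 0 v] by auto
      define v' where "v' = (\<chi> i. if i = j then v $ j - 1 else v $ i)"
      have "v = axis j 1 + v'" using j by (auto simp: v'_def vec_eq_iff axis_component)
      then have "c = column j A + A *v v'" "vec_sum v' = k"
        using v by (simp_all only: matrix_vector_right_distrib matrix_vector_axis vec_sum_add vec_sum_axis)
      then show "c \<in> ?L" by blast
    qed
  qed
  then show ?case by (simp add: Suc ideal_mult_mon_ideal)
qed

locale frobenius_monomial =
  fixes p :: nat and A :: "nat ^ 'n::finite ^ 'm::finite" and I :: "('m, 'k::field) mpoly set"
  assumes p: "prime p" and char: "CHAR('k) = p"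
    and I: "I = ideal_gen (range (\<lambda>j. monomial (column j A)))"
begin

lemma p_gt_1: "1 < p" using p by (rule prime_gt_1_nat)

lemma p_gt_0: "0 < p" using p_gt_1 by simp

lemma I_eq: "I = mon_ideal (range (\<lambda>j. column j A))"
  by (simp add: I mon_ideal_def image_image)

lemma frob_power_mon_ideal_p:
  "frob_power (p ^ e) (mon_ideal E :: ('m, 'k) mpoly set) = mon_ideal ((*s) (p ^ e) ` E)"
  by (rule frob_power_mon_ideal[where e = e]) (use p char in simp_all)

text \<open>The shift \<open>s\<close> is what makes induction possible: after removal of the lowest
  digit of \<open>k\<close>, the remaining factors carry one more Frobenius power each.\<close>

lemma frob_int_shifted:
  "foldr (\<lambda>i. ideal_mult (frob_power (p ^ (i + s)) (ideal_power I (k div p ^ i mod p))))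
      [0..<floorlog p k] UNIV
    = mon_ideal {p ^ s *s (A *v v) | v. carry_free p v \<and> vec_sum v = k}"
proof (induction k arbitrary: s rule: less_induct)
  case (less k)
  show ?case
  proof (cases "k = 0")
    case True
    have "{p ^ s *s (A *v v) | v. carry_free p v \<and> vec_sum v = 0} = {0}"
      by (auto simp: vec_sum_eq_0_iff intro: carry_free.zero)
    then show ?thesis using True by (simp add: floorlog_def mon_ideal_UNIV)
  next
    case False
    define G where "G i = ideal_mult (frob_power (p ^ (i + s)) (ideal_power I (k div p ^ i mod p)))" for i
    \<comment> \<open>Position \<open>0\<close> is split off; the remaining positions are those of
      \<open>k div p\<close>, moved up by one.\<close>
    have upt: "[0..<floorlog p k] = 0 # map Suc [0..<floorlog p (k div p)]"
      using False p_gt_1 by (subst compute_floorlog) (simp add: map_Suc_upt upt_conv_Cons)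
    have "foldr G [0..<floorlog p k] UNIV = G 0 (foldr (\<lambda>i. G (Suc i)) [0..<floorlog p (k div p)] UNIV)"
      by (simp add: upt foldr_map o_def)
    also have "(\<lambda>i. G (Suc i)) = (\<lambda>i. ideal_mult (frob_power (p ^ (i + Suc s))
        (ideal_power I (k div p div p ^ i mod p))))"
      by (simp add: G_def div_mult2_eq)
    also have "foldr \<dots> [0..<floorlog p (k div p)] UNIV
        = mon_ideal {p ^ Suc s *s (A *v v) | v. carry_free p v \<and> vec_sum v = k div p}"
      using False p_gt_1 by (intro less) simp
    also have "G 0 \<dots> = mon_ideal {a + b | a b. a \<in> (*s) (p ^ s) ` {A *v v | v. vec_sum v = k mod p} \<and>
        b \<in> {p ^ Suc s *s (A *v v) | v. carry_free p v \<and> vec_sum v = k div p}}"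
      by (simp add: G_def I_eq ideal_power_column_ideal ideal_mult_mon_ideal frob_power_mon_ideal_p)
    also have "{a + b | a b. a \<in> (*s) (p ^ s) ` {A *v v | v. vec_sum v = k mod p} \<and>
        b \<in> {p ^ Suc s *s (A *v v) | v. carry_free p v \<and> vec_sum v = k div p}}
      = {p ^ s *s (A *v v) | v. carry_free p v \<and> vec_sum v = k}" (is "?L = ?R")
    proof -
      have *: "p ^ s *s (A *v d) + p ^ Suc s *s (A *v v) = p ^ s *s (A *v (p *s v + d))" for d v
        by (simp add: matrix_vector_right_distrib matrix_vector_scale vec_eq_iff algebra_simps)
      have "?L = {p ^ s *s (A *v (p *s v + d)) | v d. vec_sum d = k mod p \<and> carry_free p v \<and> vec_sum v = k div p}"
        unfolding *[symmetric] by blast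
      also have "\<dots> = ?R"
        unfolding carry_free_vec_sum_split[OF p_gt_0, where k = k] by blast
      finally show ?thesis .
    qed
    finally show ?thesis unfolding G_def .
  qed
qed

lemma frob_rat_eq:
  "frob_rat p I k e = mon_ideal {c. \<exists>v. carry_free p v \<and> vec_sum v = k \<and>
     (\<forall>i. (A *v v) $ i < p ^ e * (c $ i + 1))}"
proof -
  have "frob_int p I k = mon_ideal {A *v v | v. carry_free p v \<and> vec_sum v = k}"
    using frob_int_shifted[of 0 k] by (simp add: frob_int_def)
  moreover have "frob_root (p ^ e) (mon_ideal E :: ('m, 'k) mpoly set)
      = mon_ideal {c. \<exists>a\<in>E. \<forall>i. a $ i < p ^ e * (c $ i + 1)}" for E
    by (rule frob_root_mon_ideal[where e = e]) (use p char in simp_all)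
  moreover have "{c. \<exists>a\<in>{A *v v | v. carry_free p v \<and> vec_sum v = k}. \<forall>i. a $ i < p ^ e * (c $ i + 1)}
    = {c. \<exists>v. carry_free p v \<and> vec_sum v = k \<and> (\<forall>i. (A *v v) $ i < p ^ e * (c $ i + 1))}"
    by blast
  ultimately show ?thesis by (simp add: frob_rat_def)
qed

end

section \<open>Feasible vectors and changes of their level and norm\<close>

text \<open>The integer vector \<open>v\<close> stands for \<open>v / p ^ e\<close>. The inequality
  is \<open>A (v / p ^ e) \<prec> c + 1\<close> with denominators cleared, equivalently that the
  floor of \<open>A v / p ^ e\<close> is at most \<open>c\<close>.\<close>

definition feasible :: "nat \<Rightarrow> nat ^ 'n::finite ^ 'm::finite \<Rightarrow> nat ^ 'm \<Rightarrow> nat \<Rightarrow> nat ^ 'n \<Rightarrow> bool" where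
  "feasible p A c e v \<longleftrightarrow> carry_free p v \<and> (\<forall>i. (A *v v) $ i < p ^ e * (c $ i + 1))"

lemma feasible_scale:
  assumes "0 < p" "feasible p A c e v"
  shows "feasible p A c (t + e) (p ^ t *s v)"
proof -
  have "p ^ t * (A *v v) $ i < p ^ t * (p ^ e * (c $ i + 1))" for i
    by (rule mult_less_mono2) (use assms in \<open>simp_all add: feasible_def\<close>)
  then have "(A *v (p ^ t *s v)) $ i < p ^ (t + e) * (c $ i + 1)" for i
    by (simp only: matrix_vector_scale vector_smult_component power_add mult.assoc)
  then show ?thesis using assms by (simp add: feasible_def carry_free_scale)
qed

lemma feasible_mono: "feasible p A c e v \<Longrightarrow> (\<And>i. c $ i \<le> c' $ i) \<Longrightarrow> feasible p A c' e v"
  unfolding feasible_def by (meson add_le_mono1 less_le_trans mult_le_mono2)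

text \<open>As the inequalities are strict, a unit can be added in a far enough place.\<close>

lemma feasible_exceed:
  fixes A :: "nat ^ 'n::finite ^ 'm::finite"
  assumes p: "1 < p" and v: "feasible p A c e v"
  shows "\<exists>e' v'. feasible p A c e' v' \<and> vec_sum v / real p ^ e < vec_sum v' / real p ^ e'"
proof -
  obtain j :: 'n where True by simp
  define s where "s = vec_sum (column j A)"
  \<comment> \<open>Positive \<open>t\<close> makes the last digits of \<open>p ^ t *s v\<close>
    zero, so the added unit causes no carry. Also \<open>p ^ t\<close> exceeds every entry of column
    \<open>j\<close>, so the unit fits into the slack of the strict inequalities.\<close>
  define t where "t = Suc s"
  define v' where "v' = p ^ t *s v + axis j 1"
  have "v' = p *s (p ^ s *s v) + axis j 1" by (simp add: v'_def t_def vec_scale_scale)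
  moreover have "carry_free p (p *s (p ^ s *s v) + axis j 1)"
    using v p by (intro carry_free.step carry_free_scale) (simp_all add: feasible_def)
  ultimately have cf: "carry_free p v'" by simp
  have "(A *v v') $ i < p ^ (t + e) * (c $ i + 1)" for i
  proof -
    have "column j A $ i < t" using component_le_vec_sum[of "column j A" i] by (simp add: t_def s_def)
    also have "t < p ^ t" using p by (simp add: power_gt_expt)
    finally have "(A *v v') $ i < p ^ t * ((A *v v) $ i + 1)"
      by (simp only: v'_def matrix_vector_right_distrib matrix_vector_axis matrix_vector_scale) simp
    also have "\<dots> \<le> p ^ t * (p ^ e * (c $ i + 1))"
      using v by (intro mult_le_mono2) (simp add: feasible_def Suc_le_eq)
    finally show ?thesis by (simp only: power_add mult.assoc)
  qed
  with cf have "feasible p A c (t + e) v'" by (simp add: feasible_def)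
  moreover have "vec_sum v / real p ^ e < vec_sum v' / real p ^ (t + e)"
    using p by (simp add: v'_def vec_sum_add vec_sum_scale power_add field_simps)
  ultimately show ?thesis by blast
qed

text \<open>Pass to the common level \<open>e + e'\<close>, lower the norm to
  \<open>p ^ e' * k\<close> without creating carries, and divide: a carry-free vector of that norm
  is itself divisible by \<open>p ^ e'\<close>.\<close>

lemma feasible_lower:
  assumes p: "1 < p" and v: "feasible p A c e' v" and k: "real k / real p ^ e \<le> vec_sum v / real p ^ e'"
  shows "\<exists>u. feasible p A c e u \<and> vec_sum u = k"
proof -
  have p0: "0 < p" using p by simp
  have "real (p ^ e' * k) \<le> real (p ^ e * vec_sum v)"
    using k p0 by (simp add: field_simps)
  then have "p ^ e' * k \<le> vec_sum (p ^ e *s v)" by (simp only: of_nat_le_iff vec_sum_scale)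
  moreover have "carry_free p (p ^ e *s v)" using v p0 by (simp add: feasible_def carry_free_scale)
  ultimately obtain w where w: "carry_free p w" "vec_sum w = p ^ e' * k" "\<And>i. w $ i \<le> (p ^ e *s v) $ i"
    using carry_free_ex_le[OF p0] by blast
  then obtain u where u: "w = p ^ e' *s u" "carry_free p u" "vec_sum u = k"
    using carry_free_power_dvd[OF p0] by blast
  have "(A *v u) $ i < p ^ e * (c $ i + 1)" for i
  proof -
    have "p ^ e' * (A *v u) $ i \<le> p ^ e * (A *v v) $ i"
      using matrix_vector_mono[of w "p ^ e *s v" A i] w(3) by (simp add: u matrix_vector_scale)
    also have "\<dots> < p ^ e * (p ^ e' * (c $ i + 1))"
      using v p0 by (simp add: feasible_def)
    finally have "p ^ e' * (A *v u) $ i < p ^ e' * (p ^ e * (c $ i + 1))"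
      by (simp only: mult.left_commute)
    then show ?thesis by simp
  qed
  with u show ?thesis by (auto simp: feasible_def)
qed

lemma finite_bounded_vectors: "finite {c :: nat ^ 'm::finite. \<forall>i. c $ i \<le> B}"
proof -
  have "{c :: nat ^ 'm. \<forall>i. c $ i \<le> B} \<subseteq> vec_lambda ` (UNIV \<rightarrow>\<^sub>E {..B})"
    by (auto intro!: image_eqI[where x = "\<lambda>i. _ $ i"] simp: vec_nth_inverse PiE_UNIV_domain)
  then show ?thesis by (rule finite_subset) (intro finite_imageI finite_PiE; simp)
qed

text \<open>Rounding up to \<open>j\<close> places is a sequence of the kind over which
  \<open>frob_real\<close> quantifies. Without one such sequence the stable value would not be
  unique.\<close>

lemma ceiling_approximations:
  assumes "1 < p" "0 \<le> lam"
  shows "decseq (\<lambda>j. real (nat \<lceil>lam * real p ^ j\<rceil>) / real p ^ j)"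
    and "lam \<le> real (nat \<lceil>lam * real p ^ j\<rceil>) / real p ^ j"
    and "(\<lambda>j. real (nat \<lceil>lam * real p ^ j\<rceil>) / real p ^ j) \<longlonglongrightarrow> lam"
proof -
  let ?x = "\<lambda>j. real (nat \<lceil>lam * real p ^ j\<rceil>) / real p ^ j"
  have p0: "0 < real p ^ j" for j using assms by simp
  have ceil: "real (nat \<lceil>lam * real p ^ j\<rceil>) = of_int \<lceil>lam * real p ^ j\<rceil>" for j
    using assms by simp
  show lower: "lam \<le> ?x j" for j
    unfolding ceil using p0[of j] by (simp add: pos_le_divide_eq)
  have "?x (Suc j) \<le> ?x j" for j
  proof -
    have "lam * real p ^ Suc j \<le> of_int (\<lceil>lam * real p ^ j\<rceil> * int p)"
      using le_of_int_ceiling[of "lam * real p ^ j"] assms by (simp add: mult.commute mult.left_commute mult_left_mono)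
    then have "\<lceil>lam * real p ^ Suc j\<rceil> \<le> \<lceil>lam * real p ^ j\<rceil> * int p" by (rule ceiling_le)
    then have "real_of_int \<lceil>lam * real p ^ Suc j\<rceil> \<le> of_int \<lceil>lam * real p ^ j\<rceil> * real p"
      by (metis of_int_le_iff of_int_mult of_int_of_nat_eq)
    then show ?thesis unfolding ceil using p0[of j] assms(1) by (simp add: field_simps)
  qed
  then show "decseq ?x" by (rule decseq_SucI)
  have upper: "?x j \<le> lam + (1 / real p) ^ j" for j
    unfolding ceil using p0[of j] of_int_ceiling_le_add_one[of "lam * real p ^ j"]
    by (simp add: field_simps power_one_over)
  have "(\<lambda>j. lam + (1 / real p) ^ j) \<longlonglongrightarrow> lam + 0"
    using assms by (intro tendsto_intros LIMSEQ_power_zero) simp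
  then show "?x \<longlonglongrightarrow> lam"
    using lower upper by (intro tendsto_sandwich[OF _ _ tendsto_const, of lam ?x]) simp_all
qed

section \<open>Real Frobenius exponents and the critical exponent\<close>

context frobenius_monomial
begin

lemma frob_rat_feasible:
  "frob_rat p I k e = mon_ideal {c. \<exists>v. feasible p A c e v \<and> vec_sum v = k}"
proof -
  have "{c. \<exists>v. carry_free p v \<and> vec_sum v = k \<and> (\<forall>i. (A *v v) $ i < p ^ e * (c $ i + 1))}
      = {c. \<exists>v. feasible p A c e v \<and> vec_sum v = k}" unfolding feasible_def by blast
  then show ?thesis by (simp only: frob_rat_eq)
qed

text \<open>A fixed \<open>c\<close> in the limit set is eventually reached: its feasible norm can
  be pushed strictly above \<open>lam\<close> by \<open>feasible_exceed\<close> and then lowered to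
  \<open>k j / p ^ e j\<close>. Uniformity in \<open>c\<close> follows because finitely many
  exponents generate.\<close>

lemma eventually_frob_rat_eq:
  fixes k e :: "nat \<Rightarrow> nat"
  assumes lower: "\<And>j. lam \<le> real (k j) / real p ^ e j"
    and lim: "(\<lambda>j. real (k j) / real p ^ e j) \<longlonglongrightarrow> lam"
  shows "\<forall>\<^sub>F j in sequentially. frob_rat p I (k j) (e j)
    = mon_ideal {c. \<exists>e v. feasible p A c e v \<and> lam \<le> vec_sum v / real p ^ e}"
proof -
  define N where "N = {c. \<exists>e v. feasible p A c e v \<and> lam \<le> vec_sum v / real p ^ e}"
  define M where "M j = {c. \<exists>v. feasible p A c (e j) v \<and> vec_sum v = k j}" for j
  have M_subset: "M j \<subseteq> N" for j
    using lower[of j] by (fastforce simp: M_def N_def)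
  have ev_M: "\<forall>\<^sub>F j in sequentially. c \<in> M j" if "c \<in> N" for c
  proof -
    from that obtain e0 v0 where "feasible p A c e0 v0" "lam \<le> vec_sum v0 / real p ^ e0"
      by (auto simp: N_def)
    then obtain e' v where v: "feasible p A c e' v" "lam < vec_sum v / real p ^ e'"
      using feasible_exceed[OF p_gt_1] by (meson le_less_trans)
    have "\<forall>\<^sub>F j in sequentially. real (k j) / real p ^ e j < vec_sum v / real p ^ e'"
      using order_tendstoD(2)[OF lim v(2)] .
    then show ?thesis
    proof eventually_elim
      case (elim j)
      then show ?case
        using feasible_lower[OF p_gt_1 v(1), of "k j" "e j"] by (simp add: M_def)
    qed
  qed
  \<comment> \<open>For \<open>k / p ^ e < lam + 1\<close> the minimal exponents \<open>A v div p ^ e\<close> lie in a fixed finite box.\<close>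
  define S where "S = (\<Sum>i\<in>UNIV. \<Sum>l\<in>UNIV. A $ i $ l)"
  define B where "B = nat \<lceil>real S * (lam + 1)\<rceil>"
  define box where "box = {c :: nat ^ 'm. \<forall>i. c $ i \<le> B}"
  have reduce: "\<exists>c'\<in>N \<inter> box. \<forall>i. c' $ i \<le> c $ i" if c: "c \<in> N" for c
  proof -
    have "\<forall>\<^sub>F j in sequentially. real (k j) / real p ^ e j < lam + 1"
      by (rule order_tendstoD(2)[OF lim]) simp
    with ev_M[OF c] have "\<forall>\<^sub>F j in sequentially. c \<in> M j \<and> real (k j) / real p ^ e j < lam + 1"
      by (rule eventually_conj)
    then obtain j where j: "c \<in> M j" "real (k j) / real p ^ e j < lam + 1"
      by (auto dest: eventually_happens)
    then obtain v where v: "feasible p A c (e j) v" "vec_sum v = k j" by (auto simp: M_def)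
    define c' where "c' = (\<chi> i. (A *v v) $ i div p ^ e j)"
    have pe: "0 < p ^ e j" using p_gt_0 by simp
    have "c' $ i \<le> c $ i" for i
    proof -
      have "(A *v v) $ i < (c $ i + 1) * p ^ e j"
        using v(1) by (simp only: feasible_def mult.commute)
      then have "(A *v v) $ i div p ^ e j < c $ i + 1" by (rule less_mult_imp_div_less)
      then show ?thesis by (simp add: c'_def)
    qed
    moreover have "feasible p A c' (e j) v"
      using v(1) dividend_less_times_div[OF pe] by (simp add: feasible_def c'_def)
    then have "c' \<in> M j" using v(2) by (auto simp: M_def)
    moreover have "c' $ i \<le> B" for i
    proof -
      have "(A *v v) $ i \<le> (\<Sum>l\<in>UNIV. A $ i $ l * vec_sum v)"
        unfolding matrix_vector_mult_def by (simp add: sum_mono component_le_vec_sum)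
      also have "\<dots> \<le> S * vec_sum v"
        unfolding S_def sum_distrib_right[symmetric]
        by (intro mult_le_mono1 member_le_sum[of i UNIV "\<lambda>i. \<Sum>l\<in>UNIV. A $ i $ l"]) simp_all
      finally have "(A *v v) $ i \<le> S * k j" using v(2) by simp
      then have "real ((A *v v) $ i) \<le> real S * real (k j)" by (simp flip: of_nat_mult)
      then have "real ((A *v v) $ i) / real p ^ e j \<le> real S * (real (k j) / real p ^ e j)"
        using pe by (simp add: divide_right_mono)
      also have "\<dots> \<le> real S * (lam + 1)" using j(2) by (intro mult_left_mono) simp_all
      finally have "real ((A *v v) $ i) / real (p ^ e j) \<le> real S * (lam + 1)" by simp
      moreover have "real (c' $ i) \<le> real ((A *v v) $ i) / real (p ^ e j)"
        using of_nat_div_le_of_nat[where 'a = real, of "(A *v v) $ i" "p ^ e j"] by (simp add: c'_def)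
      ultimately have "real (c' $ i) \<le> real S * (lam + 1)" by simp
      then have "real (c' $ i) \<le> real_of_int \<lceil>real S * (lam + 1)\<rceil>" by (rule order_trans) simp
      then show ?thesis unfolding B_def by linarith
    qed
    ultimately show ?thesis using M_subset[of j] unfolding box_def by blast
  qed
  have "finite (N \<inter> box)" unfolding box_def by (intro finite_Int disjI2 finite_bounded_vectors)
  then have "\<forall>\<^sub>F j in sequentially. \<forall>c\<in>N \<inter> box. c \<in> M j"
    using ev_M by (intro eventually_ball_finite) auto
  then have "\<forall>\<^sub>F j in sequentially. M j = N"
  proof eventually_elim
    case (elim j)
    have "N \<subseteq> M j"
    proof
      fix c assume "c \<in> N"
      with reduce elim obtain c' where "c' \<in> M j" "\<And>i. c' $ i \<le> c $ i" by blast
      then show "c \<in> M j" unfolding M_def by (blast intro: feasible_mono)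
    qed
    with M_subset[of j] show ?case by blast
  qed
  then show ?thesis
    by eventually_elim (simp only: frob_rat_feasible M_def N_def)
qed

lemma frob_real_eq:
  assumes "0 \<le> lam"
  shows "frob_real p I lam = mon_ideal {c. \<exists>e v. feasible p A c e v \<and> lam \<le> vec_sum v / real p ^ e}"
  unfolding frob_real_def
proof (rule the_equality)
  fix L assume "\<forall>k e :: nat \<Rightarrow> nat. decseq (\<lambda>j. real (k j) / real p ^ e j) \<longrightarrow>
     (\<forall>j. lam \<le> real (k j) / real p ^ e j) \<longrightarrow> (\<lambda>j. real (k j) / real p ^ e j) \<longlonglongrightarrow> lam \<longrightarrow>
     (\<forall>\<^sub>F j in sequentially. frob_rat p I (k j) (e j) = L)"
  from this[rule_format, of "\<lambda>j. nat \<lceil>lam * real p ^ j\<rceil>" "\<lambda>j. j"]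
  have "\<forall>\<^sub>F j in sequentially. frob_rat p I (nat \<lceil>lam * real p ^ j\<rceil>) j = L"
    using ceiling_approximations[OF p_gt_1 assms] by blast
  moreover have "\<forall>\<^sub>F j in sequentially. frob_rat p I (nat \<lceil>lam * real p ^ j\<rceil>) j
      = mon_ideal {c. \<exists>e v. feasible p A c e v \<and> lam \<le> vec_sum v / real p ^ e}"
    by (rule eventually_frob_rat_eq[OF ceiling_approximations(2,3)[OF p_gt_1 assms]])
  ultimately have "\<forall>\<^sub>F j :: nat in sequentially.
      L = mon_ideal {c. \<exists>e v. feasible p A c e v \<and> lam \<le> vec_sum v / real p ^ e}"
    by eventually_elim simp
  then show "L = mon_ideal {c. \<exists>e v. feasible p A c e v \<and> lam \<le> vec_sum v / real p ^ e}" by simp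
qed (use eventually_frob_rat_eq in blast)

lemma crit_exponent_eq:
  "crit_exponent p I b = Sup {lam. 0 \<le> lam \<and> (\<exists>e v. feasible p A b e v \<and> lam \<le> vec_sum v / real p ^ e)}"
proof -
  have "monomial b \<in> frob_real p I lam \<longleftrightarrow> (\<exists>e v. feasible p A b e v \<and> lam \<le> vec_sum v / real p ^ e)"
    if "0 \<le> lam" for lam
    unfolding frob_real_eq[OF that] monomial_in_mon_ideal_iff by (auto intro: feasible_mono)
  then show ?thesis unfolding crit_exponent_def by (intro arg_cong[of _ _ Sup]) blast
qed

lemma monomial_notin_I_iff: "monomial b \<notin> I \<longleftrightarrow> (\<forall>j. \<exists>i. b $ i < A $ i $ j)"
  by (simp add: I_eq monomial_in_mon_ideal_iff column_def not_le)

end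

subsection \<open>Digit sequences\<close>

text \<open>\<open>d (Suc j)\<close> is the vector of digits in the place of weight \<open>1 / p ^ Suc j\<close>; \<open>d 0\<close> is not used.\<close>

primrec from_digits :: "nat \<Rightarrow> (nat \<Rightarrow> nat ^ 'n::finite) \<Rightarrow> nat \<Rightarrow> nat ^ 'n" where
  "from_digits p d 0 = 0"
| "from_digits p d (Suc e) = p *s from_digits p d e + d (Suc e)"

definition digit_seq :: "nat \<Rightarrow> (nat \<Rightarrow> nat ^ 'n::finite) \<Rightarrow> bool" where
  "digit_seq p d \<longleftrightarrow> (\<forall>j. vec_sum (d (Suc j)) < p)"

definition digits_norm :: "nat \<Rightarrow> (nat \<Rightarrow> nat ^ 'n::finite) \<Rightarrow> real" where
  "digits_norm p d = suminf (\<lambda>j. real (vec_sum (d (Suc j))) / real p ^ Suc j)"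

lemma from_digits_cong:
  "(\<And>j. j < e \<Longrightarrow> d (Suc j) = d' (Suc j)) \<Longrightarrow> from_digits p d e = from_digits p d' e"
  by (induction e) simp_all

lemma from_digits_zeros:
  assumes "\<And>j. e < j \<Longrightarrow> d j = 0"
  shows "from_digits p d (k + e) = p ^ k *s from_digits p d e"
proof (induction k)
  case (Suc k)
  then show ?case using assms[of "Suc (k + e)"] by (simp add: vec_scale_scale)
qed simp

lemma carry_free_from_digits: "digit_seq p d \<Longrightarrow> carry_free p (from_digits p d e)"
  by (induction e) (auto simp: digit_seq_def intro: carry_free.intros)

lemma digit_seq_component_less: "digit_seq p d \<Longrightarrow> d (Suc j) $ i < p"
  unfolding digit_seq_def by (meson component_le_vec_sum le_less_trans)

text \<open>All later digits of a component are below \<open>p\<close>, so integer division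
  truncates exactly.\<close>

lemma from_digits_div:
  assumes "digit_seq p d"
  shows "from_digits p d (k + e) $ i div p ^ k = from_digits p d e $ i"
proof (induction k)
  case (Suc k)
  have "from_digits p d (Suc k + e) $ i div p ^ Suc k = from_digits p d (Suc k + e) $ i div p div p ^ k"
    by (simp add: div_mult2_eq)
  also have "from_digits p d (Suc k + e) $ i div p = from_digits p d (k + e) $ i"
    using digit_seq_component_less[OF assms, of "k + e" i] by simp
  finally show ?case using Suc by simp
qed simp

lemma from_digits_mod:
  "digit_seq p d \<Longrightarrow> from_digits p d (Suc e) $ i mod p = d (Suc e) $ i"
  using digit_seq_component_less[of p d e i] by simp

text \<open>The form with \<open>mod p\<close> also covers place \<open>0\<close>, where
  \<open>from_digits\<close> is \<open>0\<close>; at positive places up to \<open>e\<close> it is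
  the digit of \<open>d\<close>, by \<open>from_digits_mod\<close>.\<close>

lemma digit_from_digits:
  assumes "1 < p" "digit_seq p d"
  shows "digit p (real (from_digits p d e $ i) / real p ^ e) j
    = (if j \<le> e then from_digits p d j $ i mod p else 0)"
proof (cases "j \<le> e")
  case True
  then obtain k where e: "e = k + j" by (metis le_add_diff_inverse2)
  have "real (from_digits p d e $ i) / real p ^ e * real p ^ j = real (from_digits p d e $ i) / real (p ^ k)"
    using assms by (simp add: e power_add field_simps)
  then have "nat \<lfloor>real (from_digits p d e $ i) / real p ^ e * real p ^ j\<rfloor> = from_digits p d e $ i div p ^ k"
    by (simp only: floor_divide_of_nat_eq nat_int)
  then show ?thesis using True by (simp add: digit_def e from_digits_div[OF assms(2)])
next
  case False
  then obtain k where j: "j = Suc k + e" by (metis add.commute add_Suc_right less_iff_Suc_add not_le)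
  have "real (from_digits p d e $ i) / real p ^ e * real p ^ j = real (from_digits p d e $ i * p ^ Suc k)"
    using assms by (simp add: j power_add field_simps)
  then have "nat \<lfloor>real (from_digits p d e $ i) / real p ^ e * real p ^ j\<rfloor> = from_digits p d e $ i * p ^ Suc k"
    by (simp only: floor_of_nat nat_int)
  then show ?thesis using False by (simp add: digit_def)
qed

lemma from_digits_norm:
  assumes "0 < p"
  shows "real (vec_sum (from_digits p d e)) / real p ^ e = (\<Sum>j<e. real (vec_sum (d (Suc j))) / real p ^ Suc j)"
proof (induction e)
  case (Suc e)
  have "real (vec_sum (from_digits p d (Suc e))) / real p ^ Suc e
      = real (vec_sum (from_digits p d e)) / real p ^ e + real (vec_sum (d (Suc e))) / real p ^ Suc e"
    using assms by (simp add: vec_sum_add vec_sum_scale field_simps)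
  with Suc show ?case by simp
qed simp

context
  fixes p :: nat and d :: "nat \<Rightarrow> nat ^ 'n::finite"
  assumes p: "1 < p" and d: "digit_seq p d"
begin

text \<open>The series with the largest possible digit sum in every place; it dominates every norm
  series and bounds tails.\<close>

lemma maximal_digits_sums: "(\<lambda>j. real (p - 1) / real p ^ Suc j) sums 1"
proof -
  have "(\<lambda>j. (1 / real p) ^ j) sums (1 / (1 - 1 / real p))"
    using p by (intro geometric_sums) simp
  then have "(\<lambda>j. real (p - 1) / real p * (1 / real p) ^ j) sums (real (p - 1) / real p * (1 / (1 - 1 / real p)))"
    by (rule sums_mult)
  moreover have "real (p - 1) / real p * (1 / (1 - 1 / real p)) = 1"
    using p by (simp add: field_simps of_nat_diff)
  ultimately show ?thesis using p by (simp add: power_one_over)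
qed

lemma digit_le: "real (vec_sum (d (Suc j))) / real p ^ Suc j \<le> real (p - 1) / real p ^ Suc j"
proof -
  have "vec_sum (d (Suc j)) < p" using d by (simp add: digit_seq_def)
  then have "vec_sum (d (Suc j)) \<le> p - 1" by simp
  then have "real (vec_sum (d (Suc j))) \<le> real (p - 1)" by (simp only: of_nat_le_iff)
  then show ?thesis by (intro divide_right_mono) simp_all
qed

lemma summable_digits: "summable (\<lambda>j. real (vec_sum (d (Suc j))) / real p ^ Suc j)"
  by (rule summable_comparison_test'[OF sums_summable[OF maximal_digits_sums], of 0])
     (use digit_le in simp)

lemma digits_norm_le_1: "digits_norm p d \<le> 1"
  unfolding digits_norm_def using maximal_digits_sums
  by (intro sums_le[OF digit_le summable_sums[OF summable_digits]])

lemma digits_norm_split: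
  "digits_norm p d = real (vec_sum (from_digits p d e)) / real p ^ e + digits_norm p (\<lambda>j. d (e + j)) / real p ^ e"
proof -
  let ?f = "\<lambda>j. real (vec_sum (d (Suc j))) / real p ^ Suc j"
  have "digits_norm p d = suminf (\<lambda>j. ?f (j + e)) + (\<Sum>j<e. ?f j)"
    unfolding digits_norm_def by (rule suminf_split_initial_segment[OF summable_digits])
  also have "suminf (\<lambda>j. ?f (j + e)) = suminf (\<lambda>j. real (vec_sum (d (e + Suc j))) / real p ^ Suc j / real p ^ e)"
    by (simp add: power_add add.commute mult.assoc)
  also have "\<dots> = digits_norm p (\<lambda>j. d (e + j)) / real p ^ e"
  proof -
    have "summable (\<lambda>j. ?f (j + e) * real p ^ e)"
      by (intro summable_mult2 summable_ignore_initial_segment summable_digits)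
    moreover have "(\<lambda>j. ?f (j + e) * real p ^ e) = (\<lambda>j. real (vec_sum (d (e + Suc j))) / real p ^ Suc j)"
      using p by (simp add: power_add add.commute field_simps)
    ultimately show ?thesis unfolding digits_norm_def by (simp only: suminf_divide)
  qed
  also have "(\<Sum>j<e. ?f j) = real (vec_sum (from_digits p d e)) / real p ^ e"
    using p by (simp add: from_digits_norm)
  finally show ?thesis by simp
qed

end

lemma digits_norm_zeros:
  assumes "\<And>j. e < j \<Longrightarrow> d j = 0" "1 < p" "digit_seq p d"
  shows "digits_norm p d = real (vec_sum (from_digits p d e)) / real p ^ e"
  unfolding digits_norm_split[OF assms(2,3), of e]
  using assms(1) by (simp add: digits_norm_def)

lemma digits_norm_cong:
  "(\<And>j. d (Suc j) = d' (Suc j)) \<Longrightarrow> digits_norm p d = digits_norm p d'"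
  by (simp add: digits_norm_def)

lemma digit_seq_shift: "digit_seq p d \<Longrightarrow> digit_seq p (\<lambda>j. d (e + j))"
  by (simp add: digit_seq_def)

subsection \<open>Integral residuals\<close>

text \<open>From here on the argument is purely combinatorial: \<open>col\<close> encodes that
  \<open>x^b\<close> is not in the ideal.\<close>

locale residual_recursion =
  fixes p :: nat and A :: "nat ^ 'n::finite ^ 'm::finite" and b :: "nat ^ 'm" and \<Omega> :: int
  assumes p: "1 < p" and col: "\<And>j. \<exists>i. b $ i < A $ i $ j"
    and \<Omega>: "\<And>v :: nat ^ 'n. vec_sum v < p \<Longrightarrow> \<forall>i. int ((A *v v) $ i) \<le> \<Omega>"
begin

lemma p_pos: "0 < p" using p by simp

text \<open>A unit vector is an allowed \<open>v\<close>, and by \<open>col\<close> its column has a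
  positive entry. Hence cutting off at \<open>\<Omega>\<close> never changes whether a residual
  entry is positive.\<close>

lemma \<Omega>_ge_1: "1 \<le> \<Omega>"
proof -
  obtain j :: 'n where True by simp
  obtain i where "b $ i < A $ i $ j" using col by blast
  then have "1 \<le> int ((A *v axis j 1) $ i)"
    by (simp only: matrix_vector_axis) (simp add: column_def)
  also have "\<dots> \<le> \<Omega>" using \<Omega>[of "axis j 1"] p by simp
  finally show ?thesis .
qed

text \<open>The procedure's residual for \<open>u = v / p ^ e\<close>; as an integer vector it
  visibly takes finitely many positive values.\<close>

definition res :: "nat \<Rightarrow> nat ^ 'n \<Rightarrow> int ^ 'm" where
  "res e v = (\<chi> i. min \<Omega> (int (p ^ e * (b $ i + 1)) - int ((A *v v) $ i)))"

definition next_res :: "int ^ 'm \<Rightarrow> nat ^ 'n \<Rightarrow> int ^ 'm" where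
  "next_res r d = (\<chi> i. min \<Omega> (int p * r $ i - int ((A *v d) $ i)))"

text \<open>Cutting off at \<open>\<Omega>\<close> loses nothing: from an entry \<open>\<ge> \<Omega>\<close> one step leads to
  \<open>\<ge> p \<Omega> - \<Omega> \<ge> \<Omega>\<close>.\<close>

lemma res_step:
  assumes "vec_sum d < p"
  shows "res (Suc e) (p *s v + d) = next_res (res e v) d"
proof -
  have "min \<Omega> (int (p ^ Suc e * (b $ i + 1)) - int ((A *v (p *s v + d)) $ i))
      = min \<Omega> (int p * min \<Omega> (int (p ^ e * (b $ i + 1)) - int ((A *v v) $ i)) - int ((A *v d) $ i))" for i
  proof -
    define R where "R = int (p ^ e * (b $ i + 1)) - int ((A *v v) $ i)"
    have *: "int (p ^ Suc e * (b $ i + 1)) - int ((A *v (p *s v + d)) $ i) = int p * R - int ((A *v d) $ i)"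
      by (simp add: R_def matrix_vector_right_distrib matrix_vector_scale algebra_simps)
    have d: "int ((A *v d) $ i) \<le> \<Omega>" using \<Omega>[OF assms] by blast
    have p2: "2 * x \<le> int p * x" if "0 \<le> x" for x using that p by (intro mult_right_mono) simp_all
    show ?thesis
    proof (cases "R \<le> \<Omega>")
      case True
      then show ?thesis unfolding * R_def[symmetric] by simp
    next
      case False
      then have "0 \<le> \<Omega>" "0 \<le> R" using \<Omega>_ge_1 by simp_all
      then have "2 * \<Omega> \<le> int p * \<Omega>" "2 * R \<le> int p * R" by (simp_all only: p2)
      then have "\<Omega> \<le> int p * \<Omega> - int ((A *v d) $ i)" "\<Omega> \<le> int p * R - int ((A *v d) $ i)"
        using False d by linarith+
      then show ?thesis using False unfolding * R_def[symmetric] by simp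
    qed
  qed
  then show ?thesis by (simp add: res_def next_res_def vec_eq_iff)
qed

lemma res_pos_iff: "0 < res e v $ i \<longleftrightarrow> (A *v v) $ i < p ^ e * (b $ i + 1)"
proof -
  have "0 < res e v $ i \<longleftrightarrow> int ((A *v v) $ i) < int (p ^ e * (b $ i + 1))"
    using \<Omega>_ge_1 by (simp add: res_def)
  then show ?thesis by (simp only: of_nat_less_iff)
qed

lemma res_le: "res e v $ i \<le> \<Omega>"
  by (simp add: res_def)

lemma feasible_iff_res: "feasible p A b e v \<longleftrightarrow> carry_free p v \<and> (\<forall>i. 0 < res e v $ i)"
  by (simp add: feasible_def res_pos_iff)

definition admissible :: "(nat \<Rightarrow> nat ^ 'n) \<Rightarrow> bool" where
  "admissible d \<longleftrightarrow> digit_seq p d \<and> (\<forall>e i. 0 < res e (from_digits p d e) $ i)"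

lemma admissible_feasible: "admissible d \<Longrightarrow> feasible p A b e (from_digits p d e)"
  by (simp add: feasible_iff_res admissible_def carry_free_from_digits)

lemma res_from_digits_Suc:
  "digit_seq p d \<Longrightarrow>
    res (Suc e) (from_digits p d (Suc e)) = next_res (res e (from_digits p d e)) (d (Suc e))"
  by (simp add: res_step digit_seq_def)

text \<open>The residual is the whole memory of the digit recursion: from equal residuals, equal
  further digits lead to equal residuals. Both deleting and repeating a block rest on this.\<close>

lemma res_from_digits_transfer:
  assumes "digit_seq p d" "digit_seq p d'"
    and "res c (from_digits p d c) = res e (from_digits p d' e)"
    and "\<And>k. d (Suc (c + k)) = d' (Suc (e + k))"
  shows "res (c + k) (from_digits p d (c + k)) = res (e + k) (from_digits p d' (e + k))"
proof (induction k)
  case (Suc k)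
  then show ?case
    using assms(4)[of k] unfolding add_Suc_right res_from_digits_Suc[OF assms(1)] res_from_digits_Suc[OF assms(2)]
    by simp
qed (use assms in simp)


subsection \<open>The supremum of the feasible norms\<close>

definition feasible_sup :: real where
  "feasible_sup = Sup {lam. 0 \<le> lam \<and> (\<exists>e v. feasible p A b e v \<and> lam \<le> vec_sum v / real p ^ e)}"

text \<open>A row \<open>i\<close> with \<open>b $ i < A $ i $ j\<close> bounds component
  \<open>j\<close>. This keeps all entries of \<open>v / p ^ e\<close> below \<open>1\<close> and
  the norms bounded.\<close>

lemma feasible_component_less:
  assumes "feasible p A b e v"
  shows "v $ j < p ^ e"
proof -
  obtain i where i: "b $ i < A $ i $ j" using col by blast
  have "A $ i $ j * v $ j \<le> (A *v v) $ i"
    unfolding matrix_vector_mult_def by (simp add: member_le_sum[of j UNIV "\<lambda>j. A $ i $ j * v $ j"])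
  also have "\<dots> < p ^ e * (b $ i + 1)" using assms by (simp add: feasible_def)
  also have "\<dots> \<le> p ^ e * A $ i $ j" using i by (intro mult_le_mono2) simp
  finally show ?thesis by (simp add: mult.commute)
qed

lemma feasible_norm_le:
  assumes "feasible p A b e v"
  shows "vec_sum v \<le> CARD('n) * p ^ e"
proof -
  have "vec_sum v \<le> (\<Sum>j\<in>(UNIV :: 'n set). p ^ e)"
    unfolding vec_sum_def using feasible_component_less[OF assms] by (intro sum_mono) (simp add: less_imp_le)
  then show ?thesis by simp
qed

lemma feasible_le_sup:
  assumes "feasible p A b e v"
  shows "vec_sum v / real p ^ e \<le> feasible_sup"
  unfolding feasible_sup_def
proof (rule cSup_upper)
  show "vec_sum v / real p ^ e \<in> {lam. 0 \<le> lam \<and> (\<exists>e v. feasible p A b e v \<and> lam \<le> vec_sum v / real p ^ e)}"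
    using assms by auto
  have "vec_sum v / real p ^ e \<le> CARD('n)" if "feasible p A b e v" for e v
  proof -
    have "real (vec_sum v) \<le> real (CARD('n) * p ^ e)"
      using feasible_norm_le[OF that] by (simp only: of_nat_le_iff)
    then show ?thesis using p by (simp add: pos_divide_le_eq)
  qed
  then show "bdd_above {lam. 0 \<le> lam \<and> (\<exists>e v. feasible p A b e v \<and> lam \<le> vec_sum v / real p ^ e)}"
    by (intro bdd_aboveI[of _ "real CARD('n)"]) (auto intro: order_trans)
qed

lemma feasible_less_sup:
  "feasible p A b e v \<Longrightarrow> vec_sum v / real p ^ e < feasible_sup"
  using feasible_exceed[OF p] feasible_le_sup by (meson less_le_trans)

lemma feasible_zero: "feasible p A b e 0"
  using p by (simp add: feasible_def carry_free.zero)

lemma digits_norm_le_sup: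
  assumes "admissible d"
  shows "digits_norm p d \<le> feasible_sup"
  unfolding digits_norm_def
proof (rule suminf_le_const)
  show "summable (\<lambda>j. real (vec_sum (d (Suc j))) / real p ^ Suc j)"
    using assms p by (intro summable_digits) (auto simp: admissible_def)
  show "(\<Sum>j<e. real (vec_sum (d (Suc j))) / real p ^ Suc j) \<le> feasible_sup" for e
    using feasible_le_sup[OF admissible_feasible[OF assms], of e] p by (simp only: from_digits_norm[OF p_pos])
qed

section \<open>Norm-maximal feasible vectors and their prefixes\<close>

definition optimal :: "nat \<Rightarrow> nat ^ 'n \<Rightarrow> bool" where
  "optimal e v \<longleftrightarrow> feasible p A b e v \<and> (\<forall>u. feasible p A b e u \<longrightarrow> vec_sum u \<le> vec_sum v)"

lemma ex_optimal: "\<exists>v. optimal e v"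
  unfolding optimal_def
  by (rule ex_has_greatest_nat[of "feasible p A b e" 0 _ "Suc (CARD('n) * p ^ e)"])
     (auto simp: feasible_zero feasible_norm_le less_Suc_eq_le)

text \<open>A feasible norm at any level exceeding this bound could be lowered to
  \<open>vec_sum v + 1\<close> units at level \<open>e\<close>, against maximality.\<close>

lemma optimal_near_sup:
  assumes "optimal e v"
  shows "feasible_sup \<le> vec_sum v / real p ^ e + 1 / real p ^ e"
  unfolding feasible_sup_def
proof (rule cSup_least)
  show "{lam. 0 \<le> lam \<and> (\<exists>e v. feasible p A b e v \<and> lam \<le> vec_sum v / real p ^ e)} \<noteq> {}"
    using feasible_zero by fastforce
  fix lam assume "lam \<in> {lam. 0 \<le> lam \<and> (\<exists>e v. feasible p A b e v \<and> lam \<le> vec_sum v / real p ^ e)}"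
  then obtain e' u where u: "feasible p A b e' u" "lam \<le> vec_sum u / real p ^ e'" by auto
  have "\<not> real (Suc (vec_sum v)) / real p ^ e \<le> vec_sum u / real p ^ e'"
  proof
    assume "real (Suc (vec_sum v)) / real p ^ e \<le> vec_sum u / real p ^ e'"
    then obtain w where "feasible p A b e w" "vec_sum w = Suc (vec_sum v)"
      using feasible_lower[OF p u(1)] by blast
    then show False using assms unfolding optimal_def by (metis Suc_n_not_le_n)
  qed
  with u(2) show "lam \<le> vec_sum v / real p ^ e + 1 / real p ^ e" by (simp add: add_divide_distrib)
qed

lemma feasible_prefix:
  assumes "feasible p A b (Suc e) (p *s u + d)" "carry_free p u"
  shows "feasible p A b e u"
proof -
  have "(A *v u) $ i < p ^ e * (b $ i + 1)" for i
  proof -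
    have "p * (A *v u) $ i \<le> (A *v (p *s u + d)) $ i"
      by (simp add: matrix_vector_right_distrib matrix_vector_scale)
    also have "\<dots> < p * (p ^ e * (b $ i + 1))"
      using assms(1) by (simp only: feasible_def power_Suc mult.assoc)
    finally show ?thesis by simp
  qed
  with assms(2) show ?thesis by (simp add: feasible_def)
qed

text \<open>A better prefix would be better by a full unit, which is worth \<open>p\<close> at the
  next level, whereas the last digits contribute less than \<open>p\<close>.\<close>

lemma optimal_prefix:
  assumes opt: "optimal (Suc e) (p *s u + d)" and u: "carry_free p u" and d: "vec_sum d < p"
  shows "optimal e u"
proof -
  have "vec_sum u' \<le> vec_sum u" if "feasible p A b e u'" for u'
  proof -
    have "feasible p A b (Suc e) (p *s u')" using feasible_scale[OF p_pos that, of 1] by simp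
    then have "p * vec_sum u' \<le> p * vec_sum u + vec_sum d"
      using opt by (auto simp: optimal_def vec_sum_add vec_sum_scale)
    also have "\<dots> < p * Suc (vec_sum u)" using d by simp
    finally have "vec_sum u' < Suc (vec_sum u)" by (simp only: nat_mult_less_cancel_disj)
    then show ?thesis by simp
  qed
  with opt u show ?thesis unfolding optimal_def by (blast intro: feasible_prefix)
qed

lemma optimal_from_digits_prefix:
  assumes "digit_seq p d" "optimal (k + e) (from_digits p d (k + e))"
  shows "optimal e (from_digits p d e)"
  using assms(2)
proof (induction k)
  case (Suc k)
  have "optimal (k + e) (from_digits p d (k + e))"
    using Suc.prems assms(1) carry_free_from_digits[OF assms(1)]
    by (intro optimal_prefix[of "k + e" _ "d (Suc (k + e))"]) (simp_all add: digit_seq_def)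
  then show ?case by (rule Suc.IH)
qed simp

lemma feasible_from_digits_prefix:
  assumes "digit_seq p d" "feasible p A b (k + e) (from_digits p d (k + e))"
  shows "feasible p A b e (from_digits p d e)"
  using assms(2)
proof (induction k)
  case (Suc k)
  have "feasible p A b (k + e) (from_digits p d (k + e))"
    using Suc.prems carry_free_from_digits[OF assms(1)]
    by (intro feasible_prefix[of "k + e" _ "d (Suc (k + e))"]) simp_all
  then show ?case by (rule Suc.IH)
qed simp

text \<open>Carry-freeness supplies the digits one level at a time. After \<open>e\<close> of them
  nothing is left, because a feasible vector of level \<open>0\<close> has components below
  \<open>1\<close>.\<close>

lemma feasible_ex_digits:
  assumes "feasible p A b e v"
  shows "\<exists>d. digit_seq p d \<and> from_digits p d e = v \<and> (\<forall>j>e. d j = 0)"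
  using assms
proof (induction e arbitrary: v)
  case 0
  then have "v = 0" using feasible_component_less[of 0 v] by (simp add: vec_eq_iff)
  then show ?case using p by (intro exI[of _ "\<lambda>_. 0"]) (simp add: digit_seq_def)
next
  case (Suc e)
  have "carry_free p v" using Suc.prems by (simp add: feasible_def)
  then obtain u w where v: "v = p *s u + w" "carry_free p u" "vec_sum w < p"
  proof cases
    case zero
    then show ?thesis using p by (intro that[of 0 0]) (simp_all add: carry_free.zero)
  qed (use that in blast)
  have "feasible p A b e u"
    using feasible_prefix[of e u w] Suc.prems v by simp
  from Suc.IH[OF this]
  obtain d where d: "digit_seq p d" "from_digits p d e = u" "\<forall>j>e. d j = 0" by blast
  let ?d = "d(Suc e := w)"
  have "from_digits p ?d e = from_digits p d e" by (rule from_digits_cong) simp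
  then have "from_digits p ?d (Suc e) = v" using d(2) v(1) by simp
  moreover have "digit_seq p ?d" using d(1) v(3) by (simp add: digit_seq_def)
  moreover have "\<forall>j>Suc e. ?d j = 0" using d(3) by simp
  ultimately show ?case by blast
qed

lemma admissible_zeros:
  assumes d: "digit_seq p d" "\<And>j. E < j \<Longrightarrow> d j = 0" and f: "feasible p A b E (from_digits p d E)"
  shows "admissible d"
proof -
  have "feasible p A b e (from_digits p d e)" for e
  proof (cases "e \<le> E")
    case True
    then show ?thesis using feasible_from_digits_prefix[OF d(1), of "E - e" e] f by simp
  next
    case False
    then show ?thesis
      using feasible_scale[OF p_pos f, of "e - E"] from_digits_zeros[of E d p "e - E"] d(2) by simp
  qed
  with d(1) show ?thesis by (simp add: admissible_def feasible_iff_res)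
qed

end

context residual_recursion
begin

subsection \<open>The states of the procedure\<close>

definition real_res :: "int ^ 'm \<Rightarrow> real ^ 'm" where
  "real_res r = (\<chi> i. real_of_int (r $ i))"

lemma real_res_eq_iff [simp]: "real_res r = real_res s \<longleftrightarrow> r = s"
  by (simp add: real_res_def vec_eq_iff)

definition scaled :: "nat \<Rightarrow> nat ^ 'n \<Rightarrow> real ^ 'n" where
  "scaled e v = (1 / real p ^ e) *\<^sub>R real_vec v"

lemma scaled_component: "scaled e v $ i = real (v $ i) / real p ^ e"
  by (simp add: scaled_def real_vec_def)

lemma vec_sum_scaled: "vec_sum (scaled e v) = real (vec_sum v) / real p ^ e"
  by (simp add: vec_sum_def scaled_component sum_divide_distrib)

lemma matrix_vector_scaled: "(map_matrix real A *v scaled e v) $ i = real ((A *v v) $ i) / real p ^ e"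
  by (simp add: matrix_vector_mult_def map_matrix_def scaled_component sum_divide_distrib)

lemma residual_scaled: "residual p \<Omega> A b e (scaled e v) = real_res (res e v)"
proof -
  have "real p ^ e * ((real_vec b + 1 - map_matrix real A *v scaled e v) $ i)
      = real_of_int (int (p ^ e * (b $ i + 1)) - int ((A *v v) $ i))" for i
    using p by (simp add: matrix_vector_scaled real_vec_def algebra_simps)
  then show ?thesis
    unfolding residual_def real_res_def res_def by (simp add: vec_eq_iff of_int_min del: of_nat_mult)
qed

text \<open>The pair that the procedure holds after choosing the digits \<open>d\<close> for
  \<open>e\<close> steps.\<close>

definition state :: "(nat \<Rightarrow> nat ^ 'n) \<Rightarrow> nat \<Rightarrow> ('n, 'm) state" where
  "state d e = (scaled e (from_digits p d e), map (\<lambda>j. real_res (res j (from_digits p d j))) [0..<e])"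

text \<open>A weak invariant of listed states: it forgets maximization and pruning and retains
  feasibility and the absence of repeated residuals.\<close>

definition reachable :: "(nat \<Rightarrow> nat ^ 'n) \<Rightarrow> nat \<Rightarrow> bool" where
  "reachable d e \<longleftrightarrow> digit_seq p d \<and> distinct (snd (state d e)) \<and>
     (\<forall>j\<le>e. \<forall>i. 0 < res j (from_digits p d j) $ i)"

text \<open>The constraint of the procedure is positivity of the next residual; the cut-off at
  \<open>\<Omega> \<ge> 1\<close> does not affect it.\<close>

lemma maximizers_real_res:
  "v \<in> maximizers p A (real_res r) \<longleftrightarrow>
    is_arg_max vec_sum (\<lambda>v. (\<forall>i. 0 < next_res r v $ i) \<and> vec_sum v < p) v"
proof -
  have "real_vec (A *v v) \<prec> real p *\<^sub>R real_res r \<longleftrightarrow> (\<forall>i. 0 < next_res r v $ i)" for v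
  proof -
    have "real ((A *v v) $ i) < real p * real_of_int (r $ i) \<longleftrightarrow> int ((A *v v) $ i) < int p * r $ i" for i
      by (metis of_int_less_iff of_int_mult of_int_of_nat_eq)
    then show ?thesis
      using \<Omega>_ge_1 by (simp add: prec_def real_vec_def real_res_def next_res_def)
  qed
  then show ?thesis by (simp add: maximizers_def)
qed

lemma scaled_step:
  "scaled e u + (1 / real p ^ Suc e) *\<^sub>R real_vec w = scaled (Suc e) (p *s u + w)"
  using p by (simp add: vec_eq_iff scaled_component real_vec_def field_simps)

lemma state_Suc:
  "state d (Suc e) = (fst (state d e) + (1 / real p ^ Suc e) *\<^sub>R real_vec (d (Suc e)),
     snd (state d e) @ [residual p \<Omega> A b e (fst (state d e))])"
  unfolding state_def by (simp add: scaled_step residual_scaled del: power_Suc)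

lemma state_cong:
  assumes "\<And>j. j < e \<Longrightarrow> d (Suc j) = d' (Suc j)"
  shows "state d e = state d' e"
proof -
  have "from_digits p d j = from_digits p d' j" if "j \<le> e" for j
    using that assms by (intro from_digits_cong) simp
  then show ?thesis by (simp add: state_def)
qed

lemma candidates_reachable:
  assumes L: "\<And>x. x \<in> L \<Longrightarrow> \<exists>d. x = state d e \<and> reachable d e"
    and x: "x \<in> candidates p \<Omega> A b e L"
  shows "\<exists>d. x = state d (Suc e) \<and> reachable d (Suc e)"
proof -
  from x obtain u R v where x: "x = (u + (1 / real p ^ Suc e) *\<^sub>R real_vec v, R @ [residual p \<Omega> A b e u])"
      "(u, R) \<in> L" "residual p \<Omega> A b e u \<notin> set R" "v \<in> maximizers p A (residual p \<Omega> A b e u)"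
    unfolding candidates_def by blast
  from L[OF x(2)] obtain d where d: "(u, R) = state d e" "reachable d e" by blast
  then have u: "u = fst (state d e)" "R = snd (state d e)" by (metis fst_conv, metis snd_conv)
  have r: "residual p \<Omega> A b e u = real_res (res e (from_digits p d e))"
    by (simp add: u state_def residual_scaled)
  have v: "0 < next_res (res e (from_digits p d e)) v $ i" "vec_sum v < p" for i
    using x(4) unfolding r maximizers_real_res is_arg_max_def by simp_all
  let ?d = "d(Suc e := v)"
  have same: "state ?d e = state d e" by (rule state_cong) simp
  have "x = state ?d (Suc e)"
    unfolding state_Suc same x(1) u by simp
  moreover have "reachable ?d (Suc e)"
  proof -
    have ds: "digit_seq p ?d" using d(2) v(2) by (simp add: reachable_def digit_seq_def)
    have "from_digits p ?d j = from_digits p d j" if "j \<le> e" for j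
      using that by (intro from_digits_cong) simp
    then have "0 < res j (from_digits p ?d j) $ i" if "j \<le> Suc e" for i j
      using that d(2) v(1) unfolding le_Suc_eq
      by (auto simp: reachable_def res_from_digits_Suc[OF ds] simp del: from_digits.simps)
    moreover have "distinct (snd (state ?d (Suc e)))"
      using d(2) x(3) by (simp add: state_Suc same reachable_def u)
    ultimately show ?thesis using ds by (simp add: reachable_def)
  qed
  ultimately show ?thesis by blast
qed

lemma proc_list_reachable:
  "x \<in> proc_list p \<Omega> A b e \<Longrightarrow> \<exists>d. x = state d e \<and> reachable d e"
proof (induction e arbitrary: x)
  case 0
  have "state (\<lambda>_. 0) 0 = (0, [])" by (simp add: state_def scaled_def real_vec_def vec_eq_iff)
  moreover have "reachable (\<lambda>_. 0) 0"
    using p by (simp add: reachable_def digit_seq_def state_def res_pos_iff)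
  ultimately show ?case using 0 by (metis proc_list.simps(1) singletonD)
next
  case (Suc e)
  from Suc.prems have "x \<in> candidates p \<Omega> A b e (proc_list p \<Omega> A b e)" by (simp add: prune_def)
  with Suc.IH show ?case by (rule candidates_reachable)
qed

lemma finite_maximizers: "finite (maximizers p A r)"
proof (rule finite_subset[OF _ finite_bounded_vectors])
  show "maximizers p A r \<subseteq> {v. \<forall>i. v $ i \<le> p}"
    unfolding maximizers_def is_arg_max_def
    by (auto intro: order_trans[OF component_le_vec_sum] less_imp_le)
qed

lemma finite_candidates:
  assumes "finite L"
  shows "finite (candidates p \<Omega> A b e L)"
proof -
  have "candidates p \<Omega> A b e L \<subseteq> (\<Union>(u, R)\<in>L. (\<lambda>v. (u + (1 / real p ^ Suc e) *\<^sub>R real_vec v,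
      R @ [residual p \<Omega> A b e u])) ` maximizers p A (residual p \<Omega> A b e u))"
    unfolding candidates_def by fast
  then show ?thesis
    by (rule finite_subset) (use assms finite_maximizers in auto)
qed

lemma finite_proc_list: "finite (proc_list p \<Omega> A b e)"
  by (induction e) (simp_all add: prune_def finite_candidates)

section \<open>Termination and finiteness of the output\<close>

definition residuals :: "(real ^ 'm) set" where
  "residuals = real_res ` {r. \<forall>i. 0 < r $ i \<and> r $ i \<le> \<Omega>}"

lemma finite_residuals: "finite residuals"
proof -
  have "{r :: int ^ 'm. \<forall>i. 0 < r $ i \<and> r $ i \<le> \<Omega>} \<subseteq> (\<lambda>v. \<chi> i. int (v $ i)) ` {v. \<forall>i. v $ i \<le> nat \<Omega>}"
  proof
    fix r :: "int ^ 'm" assume r: "r \<in> {r. \<forall>i. 0 < r $ i \<and> r $ i \<le> \<Omega>}"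
    then have "r = (\<chi> i. int ((\<chi> i. nat (r $ i)) $ i))" by (simp add: vec_eq_iff less_imp_le)
    moreover have "(\<chi> i. nat (r $ i)) \<in> {v. \<forall>i. v $ i \<le> nat \<Omega>}" using r by (simp add: nat_mono)
    ultimately show "r \<in> (\<lambda>v. \<chi> i. int (v $ i)) ` {v. \<forall>i. v $ i \<le> nat \<Omega>}" by (rule image_eqI)
  qed
  then show ?thesis
    unfolding residuals_def by (intro finite_imageI finite_subset[OF _ finite_imageI[OF finite_bounded_vectors]])
qed

text \<open>Pigeonhole: a state at level \<open>e\<close> carries \<open>e\<close> distinct elements
  of the finite set \<open>residuals\<close>.\<close>

lemma proc_list_empty:
  assumes "card residuals < e"
  shows "proc_list p \<Omega> A b e = {}"
proof (rule ccontr)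
  assume "proc_list p \<Omega> A b e \<noteq> {}"
  then obtain d where d: "reachable d e" using proc_list_reachable by blast
  have "set (snd (state d e)) \<subseteq> residuals"
    using d res_le by (auto simp: residuals_def state_def reachable_def)
  then have "card (set (snd (state d e))) \<le> card residuals"
    by (intro card_mono finite_residuals)
  moreover have "card (set (snd (state d e))) = e"
    using d by (subst distinct_card) (auto simp: reachable_def state_def)
  ultimately show False using assms by simp
qed

lemma finite_proc_output: "finite (proc_output p \<Omega> A b)"
proof -
  let ?f = "\<lambda>(c, e, x). repeating p c e (fst x)"
  have "proc_output p \<Omega> A b
      \<subseteq> ?f ` (SIGMA c:{..card residuals}. SIGMA e:{..card residuals}. proc_list p \<Omega> A b e)"
  proof
    fix x assume "x \<in> proc_output p \<Omega> A b"
    then obtain c e u R where x: "x = repeating p c e u" "(u, R) \<in> proc_list p \<Omega> A b e" "c < e"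
      unfolding proc_output_def by blast
    have "e \<le> card residuals" using x(2) proc_list_empty[of e] by (cases "card residuals < e") auto
    with x show "x \<in> ?f ` (SIGMA c:{..card residuals}. SIGMA e:{..card residuals}. proc_list p \<Omega> A b e)"
      by (intro image_eqI[of _ _ "(c, e, (u, R))"]) auto
  qed
  then show ?thesis
    by (rule finite_subset) (intro finite_imageI finite_SigmaI finite_atMost finite_proc_list)
qed

section \<open>Survival of norm-maximal vectors\<close>

text \<open>Replacing the last digits by any competitor in the step gives another feasible vector of
  the same level with the same prefix.\<close>

lemma optimal_maximizer:
  assumes d: "digit_seq p d" and opt: "optimal (Suc e) (from_digits p d (Suc e))"
  shows "d (Suc e) \<in> maximizers p A (real_res (res e (from_digits p d e)))"
proof -
  let ?r = "res e (from_digits p d e)"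
  have step: "res (Suc e) (p *s from_digits p d e + v) = next_res ?r v" if "vec_sum v < p" for v
    using res_step[OF that] .
  have "vec_sum v \<le> vec_sum (d (Suc e))"
    if v: "\<forall>i. 0 < next_res ?r v $ i" "vec_sum v < p" for v
  proof -
    have "feasible p A b (Suc e) (p *s from_digits p d e + v)"
      using v d by (simp add: feasible_iff_res step carry_free.step carry_free_from_digits)
    then show ?thesis using opt by (auto simp: optimal_def vec_sum_add)
  qed
  moreover have "\<forall>i. 0 < next_res ?r (d (Suc e)) $ i" "vec_sum (d (Suc e)) < p"
    using opt d res_from_digits_Suc[OF d, of e] by (simp_all only: optimal_def feasible_iff_res digit_seq_def) blast+
  ultimately show ?thesis
    unfolding maximizers_real_res is_arg_max_def by (meson leD)
qed

text \<open>The second alternative records that the state was treated at a level where its residual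
  repeats. Until then each step offers the next digits of \<open>d\<close> as maximizers, and
  pruning cannot remove the result.\<close>

lemma optimal_survives:
  assumes d: "digit_seq p d" and opt: "\<And>j. j \<le> e \<Longrightarrow> optimal j (from_digits p d j)"
  shows "state d e \<in> proc_list p \<Omega> A b e \<or>
    (\<exists>c e'. c < e' \<and> state d e' \<in> proc_list p \<Omega> A b e' \<and>
      res e' (from_digits p d e') = res c (from_digits p d c))"
  using opt
proof (induction e)
  case 0
  then show ?case by (simp add: state_def scaled_def real_vec_def vec_eq_iff)
next
  case (Suc e)
  show ?case
  proof (cases "state d e \<in> proc_list p \<Omega> A b e")
    case False
    with Suc show ?thesis by (meson le_Suc_eq)
  next
    case True
    let ?u = "fst (state d e)" and ?R = "snd (state d e)"
    have r: "residual p \<Omega> A b e ?u = real_res (res e (from_digits p d e))"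
      by (simp add: state_def residual_scaled)
    show ?thesis
    proof (cases "residual p \<Omega> A b e ?u \<in> set ?R")
      case repeat: True
      then obtain c where "c < e" "res e (from_digits p d e) = res c (from_digits p d c)"
        unfolding r by (auto simp: state_def)
      with True show ?thesis by blast
    next
      case False
      let ?C = "candidates p \<Omega> A b e (proc_list p \<Omega> A b e)"
      have "(?u, ?R) \<in> proc_list p \<Omega> A b e" using True by simp
      moreover have "d (Suc e) \<in> maximizers p A (residual p \<Omega> A b e ?u)"
        unfolding r using d Suc.prems[of "Suc e"] by (intro optimal_maximizer) blast+
      ultimately have C: "state d (Suc e) \<in> ?C"
        using False unfolding candidates_def state_Suc by blast
      \<comment> \<open>Every competitor in the list comes from a feasible vector of the same level,
        so global optimality beats it, whichever prefix it extends.\<close>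
      have "vec_sum (fst x) \<le> vec_sum (fst (state d (Suc e)))" if x: "x \<in> ?C" for x
      proof -
        from candidates_reachable[OF proc_list_reachable x]
        obtain d' where d': "x = state d' (Suc e)" "reachable d' (Suc e)" by blast
        then have "feasible p A b (Suc e) (from_digits p d' (Suc e))"
          by (auto simp: feasible_iff_res reachable_def intro: carry_free_from_digits
              simp del: from_digits.simps)
        then have "vec_sum (from_digits p d' (Suc e)) \<le> vec_sum (from_digits p d (Suc e))"
          using Suc.prems[of "Suc e"] unfolding optimal_def by blast
        then show ?thesis
          unfolding d'(1) state_def fst_conv vec_sum_scaled by (intro divide_right_mono) simp_all
      qed
      then have "Max ((\<lambda>(w, R). vec_sum w) ` ?C) \<le> vec_sum (fst (state d (Suc e)))"
        using C by (intro Max.boundedI) (auto simp: finite_candidates finite_proc_list)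
      then have "state d (Suc e) \<in> prune ?C"
        using C by (auto simp: prune_def)
      then show ?thesis by simp
    qed
  qed
qed

end

subsection \<open>Repeating expansions\<close>

text \<open>The index map inside \<open>repeating\<close>: places after \<open>c\<close> run
  cyclically through \<open>Suc c\<close> to \<open>e\<close>.\<close>

definition repeat_index :: "nat \<Rightarrow> nat \<Rightarrow> nat \<Rightarrow> nat" where
  "repeat_index c e j = (if j \<le> c then j else Suc c + (j - Suc c) mod (e - c))"

lemma repeat_index_id: "j \<le> e \<Longrightarrow> repeat_index c e j = j"
  by (simp add: repeat_index_def)

lemma repeat_index_le: "c < e \<Longrightarrow> repeat_index c e (Suc j) \<le> e"
  using mod_less_divisor[of "e - c" "j - c"] unfolding repeat_index_def by (auto simp del: mod_less_divisor)

lemma repeat_index_pos: "0 < repeat_index c e (Suc j)"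
  by (simp add: repeat_index_def)

lemma repeat_index_period:
  assumes "c < e"
  shows "repeat_index c e (Suc (e + k)) = repeat_index c e (Suc (c + k))"
proof -
  have "e + k - c = k + (e - c)" using assms by simp
  then have "(e + k - c) mod (e - c) = k mod (e - c)" by (simp only: mod_add_self2)
  then show ?thesis using assms by (simp add: repeat_index_def)
qed

definition expansion_digits :: "'n::finite expansion \<Rightarrow> nat \<Rightarrow> nat ^ 'n" where
  "expansion_digits x j = (\<chi> i. (x $ i) j)"

text \<open>Each component series is dominated by the series of digit sums, so the finite sum and
  the series may be exchanged.\<close>

lemma vec_sum_exp_value:
  assumes p: "1 < p" and d: "digit_seq p (expansion_digits x)"
  shows "vec_sum (exp_value p x) = digits_norm p (expansion_digits x)"
proof -
  have "summable (\<lambda>j. real ((x $ i) (Suc j)) / real p ^ Suc j)" for i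
  proof (rule summable_comparison_test'[OF summable_digits[OF p d], of 0])
    fix j
    have "(x $ i) (Suc j) \<le> vec_sum (expansion_digits x (Suc j))"
      using component_le_vec_sum[of "expansion_digits x (Suc j)" i] by (simp add: expansion_digits_def)
    then show "norm (real ((x $ i) (Suc j)) / real p ^ Suc j)
        \<le> real (vec_sum (expansion_digits x (Suc j))) / real p ^ Suc j"
      by (simp add: divide_right_mono del: power_Suc)
  qed
  then have "vec_sum (exp_value p x)
      = suminf (\<lambda>j. \<Sum>i\<in>UNIV. real ((x $ i) (Suc j)) / real p ^ Suc j)"
    unfolding vec_sum_def exp_value_def by (simp add: suminf_sum del: power_Suc)
  also have "\<dots> = digits_norm p (expansion_digits x)"
    unfolding digits_norm_def by (simp add: vec_sum_def expansion_digits_def sum_divide_distrib)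
  finally show ?thesis .
qed

context residual_recursion
begin

lemma exp_trunc_eq: "exp_trunc p e x = scaled e (from_digits p (expansion_digits x) e)"
proof (induction e)
  case 0
  then show ?case by (simp add: exp_trunc_def vec_eq_iff scaled_component)
next
  case (Suc e)
  have "exp_trunc p (Suc e) x $ i = exp_trunc p e x $ i + real ((x $ i) (Suc e)) / real p ^ Suc e" for i
    by (simp add: exp_trunc_def)
  then show ?case
    using p by (simp add: Suc vec_eq_iff scaled_component expansion_digits_def field_simps)
qed

lemma expansion_digits_repeating:
  assumes "digit_seq p d" "c < e"
  shows "expansion_digits (repeating p c e (scaled e (from_digits p d e))) (Suc j)
    = d (repeat_index c e (Suc j))"
proof -
  obtain k where k: "repeat_index c e (Suc j) = Suc k" using repeat_index_pos gr0_conv_Suc by metis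
  have "Suc k \<le> e" using repeat_index_le[OF assms(2), of j] k by simp
  then have "digit p (scaled e (from_digits p d e) $ i) (Suc k) = d (Suc k) $ i" for i
    unfolding scaled_component digit_from_digits[OF p assms(1)] if_P from_digits_mod[OF assms(1)]
    by simp
  moreover have "expansion_digits (repeating p c e u) (Suc j)
      = (\<chi> i. digit p (u $ i) (repeat_index c e (Suc j)))" for u :: "real ^ 'n"
    by (simp add: expansion_digits_def repeating_def repeat_index_def)
  ultimately show ?thesis by (simp add: k vec_eq_iff)
qed

lemma admissible_cong:
  assumes "\<And>j. d (Suc j) = d' (Suc j)" "admissible d"
  shows "admissible d'"
proof -
  have "from_digits p d e = from_digits p d' e" for e using assms(1) by (intro from_digits_cong)
  then show ?thesis using assms by (simp add: admissible_def digit_seq_def)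
qed

lemma digit_seq_repeat:
  "digit_seq p d \<Longrightarrow> digit_seq p (\<lambda>j. d (repeat_index c e j))"
  unfolding digit_seq_def by (metis repeat_index_pos gr0_conv_Suc)

text \<open>Beyond \<open>e\<close>, the residual at \<open>e + k\<close> equals that at the smaller
  place \<open>c + k\<close>, so positivity propagates by strong induction.\<close>

lemma admissible_repeat:
  assumes d: "digit_seq p d" "\<And>j i. j \<le> e \<Longrightarrow> 0 < res j (from_digits p d j) $ i"
    and ce: "c < e" "res e (from_digits p d e) = res c (from_digits p d c)"
  shows "admissible (\<lambda>j. d (repeat_index c e j))"
proof -
  let ?r = "\<lambda>j. d (repeat_index c e j)"
  have same: "from_digits p ?r j = from_digits p d j" if "j \<le> e" for j
    using that by (intro from_digits_cong) (simp add: repeat_index_id)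
  have r: "digit_seq p ?r" using d(1) by (rule digit_seq_repeat)
  have "\<forall>i. 0 < res j (from_digits p ?r j) $ i" for j
  proof (induction j rule: less_induct)
    case (less j)
    show ?case
    proof (cases "j \<le> e")
      case True
      then show ?thesis using d(2) same by simp
    next
      case False
      then obtain k where k: "j = e + k" using le_Suc_ex nat_le_linear by blast
      have "res (e + k) (from_digits p ?r (e + k)) = res (c + k) (from_digits p ?r (c + k))"
        using ce by (intro res_from_digits_transfer[OF r r]) (simp_all add: same repeat_index_period)
      then show ?thesis using less[of "c + k"] ce k by simp
    qed
  qed
  with r show ?thesis by (simp add: admissible_def)
qed

text \<open>Deleting the block between two equal residuals shows that what follows the block is
  worth at most as much as repeating the block forever.\<close>

lemma repeat_norm_near_sup:
  assumes d: "admissible d" and ce: "c < e" "res e (from_digits p d e) = res c (from_digits p d c)"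
    and near: "feasible_sup - \<epsilon> \<le> digits_norm p d" and \<epsilon>: "0 \<le> \<epsilon>"
  shows "feasible_sup - 2 * \<epsilon> \<le> digits_norm p (\<lambda>j. d (repeat_index c e j))"
proof -
  have ds: "digit_seq p d" using d by (simp add: admissible_def)
  let ?r = "\<lambda>j. d (repeat_index c e j)"
  have r: "digit_seq p ?r" using ds by (rule digit_seq_repeat)
  define P where "P = e - c"
  have e: "e = c + P" "0 < P" using ce by (simp_all add: P_def)
  \<comment> \<open>The block in places \<open>Suc c\<close> to \<open>e\<close> is cut out.
    Equality of the residuals at \<open>c\<close> and \<open>e\<close> keeps the sequence
    admissible, so its norm is at most the supremum.\<close>
  define del where "del j = (if j \<le> c then d j else d (j + P))" for j
  have del: "digit_seq p del" using ds by (simp add: digit_seq_def del_def)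
  have del_same: "from_digits p del j = from_digits p d j" if "j \<le> c" for j
    using that by (intro from_digits_cong) (simp add: del_def)
  have "0 < res j (from_digits p del j) $ i" for i j
  proof (cases "j \<le> c")
    case True
    then show ?thesis using d by (simp add: del_same admissible_def)
  next
    case False
    then obtain k where k: "j = c + k" using le_Suc_ex nat_le_linear by blast
    have "res (c + k) (from_digits p del (c + k)) = res (e + k) (from_digits p d (e + k))"
      using ce e by (intro res_from_digits_transfer[OF del ds]) (simp_all add: del_same del_def ac_simps)
    then show ?thesis using d k by (simp add: admissible_def)
  qed
  then have "admissible del" using del by (simp add: admissible_def)
  then have del_le: "digits_norm p del \<le> feasible_sup" by (rule digits_norm_le_sup)
  \<comment> \<open>\<open>X\<close> is the value of the first \<open>c\<close> places and
    \<open>B\<close> that of the block. \<open>t\<close> and \<open>s\<close> are the tail of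
    \<open>d\<close> after \<open>e\<close> and the tail of the repeating sequence, both placed
    directly after \<open>c\<close>. The norms become \<open>X + t\<close> for \<open>del\<close>,
    \<open>X + B + t / Q\<close> for \<open>d\<close> and \<open>X + s\<close> for the repetition,
    with \<open>s = B + s / Q\<close>.\<close>
  define X where "X = vec_sum (from_digits p d c) / real p ^ c"
  define t where "t = digits_norm p (\<lambda>j. d (e + j)) / real p ^ c"
  define B where "B = vec_sum (from_digits p (\<lambda>j. d (c + j)) P) / real p ^ P / real p ^ c"
  define s where "s = digits_norm p (\<lambda>j. ?r (c + j)) / real p ^ c"
  define Q where "Q = real p ^ P"
  have Q: "2 \<le> Q"
  proof -
    have "2 \<le> real p ^ 1" using p by simp
    also have "\<dots> \<le> real p ^ P" using p e by (intro power_increasing) simp_all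
    finally show ?thesis by (simp add: Q_def)
  qed
  have "digits_norm p (\<lambda>j. del (c + j)) = digits_norm p (\<lambda>j. d (e + j))"
    by (rule digits_norm_cong) (simp add: del_def e ac_simps)
  then have 1: "X + t \<le> feasible_sup"
    using del_le digits_norm_split[OF p del, of c] by (simp add: X_def t_def del_same)
  have "digits_norm p (\<lambda>j. d (c + j))
      = vec_sum (from_digits p (\<lambda>j. d (c + j)) P) / real p ^ P + digits_norm p (\<lambda>j. d (e + j)) / real p ^ P"
    using digits_norm_split[OF p digit_seq_shift[OF ds, of c], of P] by (simp add: e ac_simps)
  then have 2: "digits_norm p d = X + B + t / Q"
    using digits_norm_split[OF p ds, of c] by (simp add: X_def B_def t_def Q_def add_divide_distrib)
  have "from_digits p ?r c = from_digits p d c"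
    using e by (intro from_digits_cong) (simp add: repeat_index_id)
  then have 3: "digits_norm p ?r = X + s"
    using digits_norm_split[OF p r, of c] by (simp add: X_def s_def)
  have "from_digits p (\<lambda>j. ?r (c + j)) P = from_digits p (\<lambda>j. d (c + j)) P"
    using e by (intro from_digits_cong) (simp add: repeat_index_id)
  moreover have "digits_norm p (\<lambda>j. ?r (c + (P + j))) = digits_norm p (\<lambda>j. ?r (c + j))"
    by (rule digits_norm_cong) (use repeat_index_period[OF ce(1)] in \<open>simp add: e add.assoc\<close>)
  ultimately have "digits_norm p (\<lambda>j. ?r (c + j))
      = vec_sum (from_digits p (\<lambda>j. d (c + j)) P) / real p ^ P + digits_norm p (\<lambda>j. ?r (c + j)) / real p ^ P"
    using digits_norm_split[OF p digit_seq_shift[OF r, of c], of P] by simp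
  then have "s = (vec_sum (from_digits p (\<lambda>j. d (c + j)) P) / real p ^ P
      + digits_norm p (\<lambda>j. ?r (c + j)) / real p ^ P) / real p ^ c"
    unfolding s_def by (rule arg_cong)
  also have "\<dots> = B + s / Q"
    by (simp add: s_def B_def Q_def add_divide_distrib mult.commute)
  finally have 4: "s = B + s / Q" .
  \<comment> \<open>This is the loss in norm from \<open>d\<close> to its repetition. Subtracting
    the estimates for \<open>del\<close> and \<open>d\<close> bounds
    \<open>\<delta> * (Q - 1)\<close> by \<open>\<epsilon>\<close>, and \<open>Q \<ge> 2\<close>
    removes the factor.\<close>
  define \<delta> where "\<delta> = (t - s) / Q"
  have "\<delta> * (Q - 1) \<le> \<epsilon>"
  proof -
    have "\<delta> * Q = t - s" using Q by (simp add: \<delta>_def)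
    moreover have "\<delta> = t / Q - s / Q" by (simp add: \<delta>_def diff_divide_distrib)
    moreover have "\<delta> * (Q - 1) = \<delta> * Q - \<delta>" by (simp add: algebra_simps)
    ultimately show ?thesis using 1 2 4 near by linarith
  qed
  then have "\<delta> \<le> \<epsilon>"
  proof (cases "0 \<le> \<delta>")
    case True
    then have "\<delta> * 1 \<le> \<delta> * (Q - 1)" using Q by (intro mult_left_mono) simp_all
    with \<open>\<delta> * (Q - 1) \<le> \<epsilon>\<close> show ?thesis by simp
  qed (use \<epsilon> in simp)
  moreover have "X + s = X + B + t / Q - \<delta>" using 4 by (simp add: \<delta>_def diff_divide_distrib)
  ultimately show ?thesis using near 2 3 by simp
qed


subsection \<open>Correctness of the output\<close>

lemma proc_output_repeat:
  assumes "digit_seq p d" "state d e \<in> proc_list p \<Omega> A b e"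
    "c < e" "res e (from_digits p d e) = res c (from_digits p d c)"
  shows "repeating p c e (scaled e (from_digits p d e)) \<in> proc_output p \<Omega> A b"
  using assms unfolding proc_output_def state_def by (fastforce simp: residual_scaled)

lemma proc_output_admissible:
  assumes "x \<in> proc_output p \<Omega> A b"
  shows "admissible (expansion_digits x)"
proof -
  obtain c e u R where x: "x = repeating p c e u" "(u, R) \<in> proc_list p \<Omega> A b e" "c < e"
      "residual p \<Omega> A b e u = R ! c"
    using assms unfolding proc_output_def by blast
  from proc_list_reachable[OF x(2)]
  obtain d where d: "(u, R) = state d e" "reachable d e" by blast
  then have u: "u = scaled e (from_digits p d e)"
    and res: "res e (from_digits p d e) = res c (from_digits p d c)"
    using x(3,4) by (auto simp: state_def residual_scaled)
  have ds: "digit_seq p d" using d by (simp add: reachable_def)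
  have "admissible (\<lambda>j. d (repeat_index c e j))"
    using d(2) x(3) res by (intro admissible_repeat) (simp_all add: reachable_def)
  then show ?thesis
    by (rule admissible_cong[rotated]) (simp add: x(1) u expansion_digits_repeating[OF ds x(3)])
qed

lemma vec_sum_exp_value_output:
  "x \<in> proc_output p \<Omega> A b \<Longrightarrow> vec_sum (exp_value p x) = digits_norm p (expansion_digits x)"
  using proc_output_admissible by (intro vec_sum_exp_value p) (simp add: admissible_def)

text \<open>At a level \<open>E\<close> past termination the list is empty, so the digits of an
  optimal vector must have met a repeated residual. Optimality costs at most
  \<open>1 / p ^ E\<close>, and repeating the block at most the same again.\<close>

lemma ex_proc_output_near_sup:
  assumes "card residuals < E"
  shows "\<exists>x\<in>proc_output p \<Omega> A b. feasible_sup - 2 / real p ^ E \<le> vec_sum (exp_value p x)"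
proof -
  obtain w where w: "optimal E w" using ex_optimal by blast
  then have "feasible p A b E w" by (simp add: optimal_def)
  then obtain d where d: "digit_seq p d" "from_digits p d E = w" "\<And>j. E < j \<Longrightarrow> d j = 0"
    using feasible_ex_digits by blast
  have adm: "admissible d"
    using d \<open>feasible p A b E w\<close> by (intro admissible_zeros[of d E]) simp_all
  have "optimal j (from_digits p d j)" if "j \<le> E" for j
    using optimal_from_digits_prefix[OF d(1), of "E - j" j] that w d(2) by simp
  from optimal_survives[OF d(1) this, of E]
  obtain c e where ce: "c < e" "state d e \<in> proc_list p \<Omega> A b e"
      "res e (from_digits p d e) = res c (from_digits p d c)"
    using proc_list_empty[OF assms] by auto
  let ?x = "repeating p c e (scaled e (from_digits p d e))"
  have "feasible_sup - 1 / real p ^ E \<le> digits_norm p d"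
    using optimal_near_sup[OF w] digits_norm_zeros[of E d p] d p by simp
  from repeat_norm_near_sup[OF adm ce(1,3) this]
  have "feasible_sup - 2 / real p ^ E \<le> digits_norm p (\<lambda>j. d (repeat_index c e j))" by simp
  also have "\<dots> = digits_norm p (expansion_digits ?x)"
    by (rule digits_norm_cong) (simp add: expansion_digits_repeating[OF d(1) ce(1)])
  finally show ?thesis
    using proc_output_repeat[OF d(1) ce(2,1,3)] vec_sum_exp_value_output by force
qed

text \<open>Output norms are limits of feasible norms, which gives one inequality. The other follows
  by letting \<open>E\<close> tend to infinity, since the maximizer does not depend on
  \<open>E\<close>.\<close>

lemma exp_value_arg_max:
  assumes "is_arg_max (\<lambda>x. vec_sum (exp_value p x)) (\<lambda>x. x \<in> proc_output p \<Omega> A b) x"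
  shows "vec_sum (exp_value p x) = feasible_sup"
proof (rule antisym)
  have x: "x \<in> proc_output p \<Omega> A b"
    and max: "\<And>y. y \<in> proc_output p \<Omega> A b \<Longrightarrow> vec_sum (exp_value p y) \<le> vec_sum (exp_value p x)"
    using assms by (auto simp: is_arg_max_def not_less)
  show "vec_sum (exp_value p x) \<le> feasible_sup"
    using x digits_norm_le_sup proc_output_admissible by (simp add: vec_sum_exp_value_output)
  have "(\<lambda>E. feasible_sup - 2 * (1 / real p) ^ E) \<longlonglongrightarrow> feasible_sup - 2 * 0"
    using p by (intro tendsto_intros LIMSEQ_power_zero) simp
  moreover have "feasible_sup - 2 * (1 / real p) ^ E \<le> vec_sum (exp_value p x)" if "card residuals < E" for E
    using ex_proc_output_near_sup[OF that] max by (force simp: power_one_over)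
  ultimately show "feasible_sup \<le> vec_sum (exp_value p x)"
    by (intro LIMSEQ_le_const2[where X = "\<lambda>E. feasible_sup - 2 * (1 / real p) ^ E"])
       (auto intro!: exI[of _ "Suc (card residuals)"])
qed

text \<open>The tail cut off after \<open>e\<close> places has norm at most
  \<open>1 / p ^ e\<close>, which gives the lower bound. The upper bound is strict because no
  feasible vector attains the supremum.\<close>

lemma witness_from_digits:
  assumes d: "admissible d" and norm: "digits_norm p d = feasible_sup"
  shows "witness p A b feasible_sup e (scaled e (from_digits p d e))"
proof -
  have ds: "digit_seq p d" using d by (simp add: admissible_def)
  have f: "feasible p A b e (from_digits p d e)" using d by (rule admissible_feasible)
  let ?v = "scaled e (from_digits p d e)"
  have "(\<Sum>i\<in>UNIV. digit p (?v $ i) j) < p" for j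
  proof (cases "j \<le> e \<and> 0 < j")
    case True
    then obtain k where k: "j = Suc k" by (metis gr0_conv_Suc)
    have "(\<Sum>i\<in>UNIV. digit p (?v $ i) j) = vec_sum (d j)"
      using True unfolding vec_sum_def scaled_component digit_from_digits[OF p ds] k from_digits_mod[OF ds] by simp
    then show ?thesis using ds by (simp add: digit_seq_def k)
  next
    case False
    \<comment> \<open>Either \<open>j = 0\<close>, the place before the point, or \<open>j\<close>
      lies beyond the last digit kept.\<close>
    then have "digit p (?v $ i) j = 0" for i
      by (auto simp: scaled_component digit_from_digits[OF p ds])
    then show ?thesis using p by simp
  qed
  moreover have "?v $ i \<le> 1" for i
    using feasible_component_less[OF f, of i] p by (simp add: scaled_component flip: of_nat_power)
  ultimately have 1: "?v \<in> no_carry_vectors p"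
    unfolding no_carry_vectors_def by (auto simp: scaled_component)
  have 2: "?v \<in> grid p e" by (auto simp: grid_def scaled_component)
  have "real ((A *v from_digits p d e) $ i) / real p ^ e < real (b $ i) + 1" for i
  proof -
    have "real ((A *v from_digits p d e) $ i) < real (p ^ e * (b $ i + 1))"
      using f by (simp only: feasible_def of_nat_less_iff)
    then show ?thesis using p by (simp add: divide_less_eq algebra_simps)
  qed
  then have 3: "map_matrix real A *v ?v \<prec> real_vec b + 1"
    by (simp add: prec_def matrix_vector_scaled real_vec_def)
  have "digits_norm p (\<lambda>j. d (e + j)) / real p ^ e \<le> 1 / real p ^ e"
    by (intro divide_right_mono digits_norm_le_1[OF p digit_seq_shift[OF ds]]) simp
  then have 4: "feasible_sup - 1 / real p ^ e \<le> vec_sum ?v"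
    using digits_norm_split[OF p ds, of e] norm by (simp add: vec_sum_scaled)
  have 5: "vec_sum ?v < feasible_sup"
    unfolding vec_sum_scaled using f by (rule feasible_less_sup)
  from 1 2 3 4 5 show ?thesis by (simp add: witness_def)
qed

text \<open>Consecutive truncations share one digit sequence, and by
  \<open>digit_from_digits\<close> their digits up to place \<open>e\<close> depend on that sequence
  alone.\<close>

lemma convergent_witnesses_arg_max:
  assumes "is_arg_max (\<lambda>x. vec_sum (exp_value p x)) (\<lambda>x. x \<in> proc_output p \<Omega> A b) x"
  shows "convergent_witnesses p A b feasible_sup (\<lambda>e. exp_trunc p e x)"
proof -
  have x: "x \<in> proc_output p \<Omega> A b" using assms by (simp add: is_arg_max_def)
  then have adm: "admissible (expansion_digits x)" by (rule proc_output_admissible)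
  then have ds: "digit_seq p (expansion_digits x)" by (simp add: admissible_def)
  have "digits_norm p (expansion_digits x) = feasible_sup"
    using exp_value_arg_max[OF assms] vec_sum_exp_value_output[OF x] by simp
  then have "witness p A b feasible_sup e (exp_trunc p e x)" for e
    unfolding exp_trunc_eq using adm by (intro witness_from_digits)
  moreover have "digit p (exp_trunc p (Suc e) x $ i) j = digit p (exp_trunc p e x $ i) j" if "j \<le> e" for e i j
    using that by (simp add: exp_trunc_eq scaled_component digit_from_digits[OF p ds] del: from_digits.simps power_Suc)
  ultimately show ?thesis by (simp add: convergent_witnesses_def)
qed

end

theorem mainTheorem1:
  fixes p :: nat and A :: "nat ^ 'n::finite ^ 'm::finite" and b :: "nat ^ 'm" and \<Omega> :: int
    and I :: "('m, 'k::field) mpoly set"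
  assumes "prime p" and "CHAR('k) = p" and "F_finite TYPE('k)"
    and "I = ideal_gen (range (\<lambda>j. monomial (column j A)))" and "I \<noteq> UNIV"
    and "monomial b \<notin> I"
    and "\<And>v :: nat ^ 'n. vec_sum v < p \<Longrightarrow> \<forall>i. int ((A *v v) $ i) \<le> \<Omega>"
  shows "(\<forall>\<^sub>F e in sequentially. proc_list p \<Omega> A b e = {}) \<and>
    finite (proc_output p \<Omega> A b) \<and>
    (\<forall>u. is_arg_max (\<lambda>u. vec_sum (exp_value p u)) (\<lambda>u. u \<in> proc_output p \<Omega> A b) u \<longrightarrow>
      crit_exponent p I b = vec_sum (exp_value p u) \<and>
      convergent_witnesses p A b (crit_exponent p I b) (\<lambda>e. exp_trunc p e u))"
proof -
  interpret frobenius_monomial p A I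
    using assms(1,2,4) by unfold_locales
  \<comment> \<open>That \<open>x^b\<close> is not in the ideal becomes the condition
    \<open>col\<close>: every column exceeds \<open>b\<close> in some row.\<close>
  interpret residual_recursion p A b \<Omega>
    using p_gt_1 assms(6,7) monomial_notin_I_iff[of b] by unfold_locales blast+
  have "crit_exponent p I b = feasible_sup"
    by (simp add: crit_exponent_eq feasible_sup_def)
  moreover have "\<forall>\<^sub>F e in sequentially. proc_list p \<Omega> A b e = {}"
    using eventually_gt_at_top[of "card residuals"] by eventually_elim (rule proc_list_empty)
  ultimately show ?thesis
    using finite_proc_output exp_value_arg_max convergent_witnesses_arg_max by auto
qed

end
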